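(* There are infinitely many imprimitive Toroidal Belyi pairs $(E,\beta)$ for which the set of quasi-critical points $\beta^{-1}\bigl(\{0,1,\infty\}\bigr)$ is a subgroup of $(E(\mathbb{C}),\oplus)$.
   Context: An elliptic curve $E$ over $\mathbb{C}$ is a non-singular curve given by a Weierstrass equation $y^2 + a_1 xy + a_3 y = x^3 + a_2 x^2 + a_4 x + a_6$ with $a_i \in \mathbb{C}$; $E(\mathbb{C})$ is its set of complex points together with the point at infinity $O_E$, an abelian group under the chord-tangent law $\oplus$ with identity $O_E$. An isogeny is a morphism of elliptic curves over $\mathbb{C}$ that is a group homomorphism on complex points. For a non-constant meromorphic (rational) function $\beta: S \to \mathbb{P}^1(\mathbb{C})$ with $S = E(\mathbb{C})$ or $S = \mathbb{P}^1(\mathbb{C})$, a critical point is a point $P \in S$ at which the ramification index $e_\beta(P)$ is at least $2$, and a critical value is the image of a critical point; $\beta$ is a Belyi map if all its critical values lie in $\{0,1,\infty\}$. A Toroidal Belyi pair $(E,\beta)$ consists of an elliptic curve $E$ over $\mathbb{C}$ and a Belyi map $\beta: E(\mathbb{C}) \to \mathbb{P}^1(\mathbb{C})$; its set of quasi-critical points is $\beta^{-1}(\{0,1,\infty\})$. A Belyi map $\gamma: \mathbb{P}^1(\mathbb{C}) \to \mathbb{P}^1(\mathbb{C})$ is dynamical if $\gamma(\{0,1,\infty\}) \subseteq \{0,1,\infty\}$. A Toroidal Belyi pair $(E,\beta)$ is imprimitive if $\beta$ can be written as a non-trivial composition $\beta = \gamma \circ \phi \circ \psi$, where $\psi: E(\mathbb{C})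 \to X(\mathbb{C})$ is an isogeny to an elliptic curve $X$, $\phi: X(\mathbb{C}) \to \mathbb{P}^1(\mathbb{C})$ is a meromorphic function, and $\gamma: \mathbb{P}^1(\mathbb{C}) \to \mathbb{P}^1(\mathbb{C})$ is a dynamical Belyi map; non-trivial means that at least one of $\gamma$, $\psi$ has degree at least $2$. *)

theory Defs
  imports "HOL-Analysis.Analysis" "HOL-Algebra.Group"
begin

section \<open>Points of complex projective space, forms, morphisms\<close>

text \<open>
  A type in this class is a set of points of a complex projective space: \<open>coords p\<close> is a
  representative of the homogeneous coordinates of \<open>p\<close>, padded with zeros.
\<close>

class projective =
  fixes coords :: "'a \<Rightarrow> nat \<Rightarrow> complex"
  assumes coords_nonzero: "\<exists>i. coords p i \<noteq> 0"
    and coords_inject: "(\<And>i. coords p i = c * coords q i) \<Longrightarrow> p = q"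

text \<open>
  \<open>form d F\<close>: \<open>F\<close> is a homogeneous polynomial of degree \<open>d\<close> in the coordinates. The zero
  polynomial is a form of every degree. Variables beyond the actual number of coordinates are
  evaluated at \<open>0\<close> and hence play no role.
\<close>

inductive form :: "nat \<Rightarrow> ((nat \<Rightarrow> complex) \<Rightarrow> complex) \<Rightarrow> bool" where
  form_const: "form 0 (\<lambda>v. c)"
| form_var: "form 1 (\<lambda>v. v i)"
| form_add: "form d F \<Longrightarrow> form d G \<Longrightarrow> form d (\<lambda>v. F v + G v)"
| form_mult: "form d F \<Longrightarrow> form e G \<Longrightarrow> form (d + e) (\<lambda>v. F v * G v)"

text \<open>
  A morphism is a map which, around every point \<open>P\<close>, is given by forms of the same degree that
  do not all vanish at \<open>P\<close>. The factor \<open>c\<close> vanishes exactly where all these forms vanish.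
  (Asking for this only on a Zariski neighbourhood \<open>H \<noteq> 0\<close> of \<open>P\<close> would give the same notion:
  multiply all \<open>F i\<close> by \<open>H\<close>.)
\<close>

definition morphism :: "'a::projective set \<Rightarrow> 'b::projective set \<Rightarrow> ('a \<Rightarrow> 'b) \<Rightarrow> bool" where
  "morphism S T f \<longleftrightarrow> f ` S \<subseteq> T \<and>
     (\<forall>P\<in>S. \<exists>d F. (\<forall>i. form d (F i)) \<and> (\<exists>i. F i (coords P) \<noteq> 0) \<and>
        (\<forall>Q\<in>S. \<exists>c. \<forall>i. F i (coords Q) = c * coords (f Q) i))"

text \<open>The degree is the number of points in all but finitely many fibres.\<close>

definition map_degree :: "'a set \<Rightarrow> 'b set \<Rightarrow> ('a \<Rightarrow> 'b) \<Rightarrow> nat" where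
  "map_degree S T f =
     (THE n. finite {Q\<in>T. \<not> (finite {P\<in>S. f P = Q} \<and> card {P\<in>S. f P = Q} = n)})"


section \<open>Local rings and ramification\<close>

definition zariski_near :: "'a::projective set \<Rightarrow> 'a \<Rightarrow> ('a \<Rightarrow> bool) \<Rightarrow> bool" where
  "zariski_near S P R \<longleftrightarrow>
     (\<exists>d H. form d H \<and> H (coords P) \<noteq> 0 \<and> (\<forall>Q\<in>S. H (coords Q) \<noteq> 0 \<longrightarrow> R Q))"

text \<open>
  The functions regular at \<open>P\<close>, up to equality near \<open>P\<close>, form the local ring of \<open>S\<close> at \<open>P\<close>. Values
  away from a neighbourhood of \<open>P\<close> are irrelevant.
\<close>

definition regular_at :: "'a::projective set \<Rightarrow> 'a \<Rightarrow> ('a \<Rightarrow> complex) \<Rightarrow> bool" where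
  "regular_at S P g \<longleftrightarrow>
     (\<exists>d F G. form d F \<and> form d G \<and> G (coords P) \<noteq> 0 \<and>
        zariski_near S P (\<lambda>Q. g Q = F (coords Q) / G (coords Q)))"

definition uniformizer :: "'a::projective set \<Rightarrow> 'a \<Rightarrow> ('a \<Rightarrow> complex) \<Rightarrow> bool" where
  "uniformizer S P \<pi> \<longleftrightarrow> regular_at S P \<pi> \<and> \<pi> P = 0 \<and>
     (\<forall>g. regular_at S P g \<and> g P = 0 \<longrightarrow>
        (\<exists>h. regular_at S P h \<and> zariski_near S P (\<lambda>Q. g Q = h Q * \<pi> Q)))"

text \<open>
  The ramification index of \<open>f\<close> at \<open>P\<close> is the order of vanishing at \<open>P\<close> of the pullback of a
  uniformizer \<open>t\<close> at \<open>f P\<close>. It is meaningful for a non-constant morphism between smooth curves.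
\<close>

definition ramification_index ::
  "'a::projective set \<Rightarrow> 'b::projective set \<Rightarrow> ('a \<Rightarrow> 'b) \<Rightarrow> 'a \<Rightarrow> nat" where
  "ramification_index S T f P =
     (THE n. \<exists>t \<pi> u. uniformizer T (f P) t \<and> uniformizer S P \<pi> \<and>
        regular_at S P u \<and> u P \<noteq> 0 \<and>
        zariski_near S P (\<lambda>Q. t (f Q) = u Q * \<pi> Q ^ n))"

definition critical_points :: "'a::projective set \<Rightarrow> 'b::projective set \<Rightarrow> ('a \<Rightarrow> 'b) \<Rightarrow> 'a set" where
  "critical_points S T f = {P\<in>S. ramification_index S T f P \<ge> 2}"

definition critical_values :: "'a::projective set \<Rightarrow> 'b::projective set \<Rightarrow> ('a \<Rightarrow> 'b) \<Rightarrow> 'b set" where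
  "critical_values S T f = f ` critical_points S T f"


section \<open>The projective line and Belyi maps\<close>

datatype proj_line = Fin complex | Infty

instantiation proj_line :: projective
begin

definition coords_proj_line :: "proj_line \<Rightarrow> nat \<Rightarrow> complex" where
  "coords_proj_line p =
     (case p of Fin z \<Rightarrow> (\<lambda>_. 0)(0 := z, 1 := 1) | Infty \<Rightarrow> (\<lambda>_. 0)(0 := 1))"

instance
proof
  fix p :: proj_line
  have "coords p 0 \<noteq> 0 \<or> coords p 1 \<noteq> 0"
    by (cases p) (simp_all add: coords_proj_line_def)
  then show "\<exists>i. coords p i \<noteq> 0"
    by blast
next
  fix p q :: proj_line and c :: complex
  assume h: "\<And>i. coords p i = c * coords q i"
  show "p = q"
    using h[of 0] h[of 1]
    by (cases p; cases q) (simp_all add: coords_proj_line_def)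
qed

end

definition zero_one_infty :: "proj_line set" where
  "zero_one_infty = {Fin 0, Fin 1, Infty}"

definition belyi_map :: "'a::projective set \<Rightarrow> ('a \<Rightarrow> proj_line) \<Rightarrow> bool" where
  "belyi_map S \<beta> \<longleftrightarrow> morphism S UNIV \<beta> \<and> \<not> \<beta> constant_on S \<and>
     critical_values S UNIV \<beta> \<subseteq> zero_one_infty"

definition dynamical_belyi_map :: "(proj_line \<Rightarrow> proj_line) \<Rightarrow> bool" where
  "dynamical_belyi_map \<gamma> \<longleftrightarrow> belyi_map UNIV \<gamma> \<and> \<gamma> ` zero_one_infty \<subseteq> zero_one_infty"


section \<open>Elliptic curves\<close>

text \<open>The Weierstrass equation \<open>y\<^sup>2 + a\<^sub>1 x y + a\<^sub>3 y = x\<^sup>3 + a\<^sub>2 x\<^sup>2 + a\<^sub>4 x + a\<^sub>6\<close>.\<close>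

record weierstrass =
  wa1 :: complex
  wa2 :: complex
  wa3 :: complex
  wa4 :: complex
  wa6 :: complex

definition weierstrass_eq :: "weierstrass \<Rightarrow> complex \<Rightarrow> complex \<Rightarrow> bool" where
  "weierstrass_eq E x y \<longleftrightarrow>
     y^2 + wa1 E * x * y + wa3 E * y = x^3 + wa2 E * x^2 + wa4 E * x + wa6 E"

text \<open>
  Non-singularity: the two partial derivatives have no common zero on the affine curve. The point
  at infinity of a Weierstrass curve is always non-singular.
\<close>

definition elliptic_curve :: "weierstrass \<Rightarrow> bool" where
  "elliptic_curve E \<longleftrightarrow>
     \<not> (\<exists>x y. weierstrass_eq E x y \<and>
          2 * y + wa1 E * x + wa3 E = 0 \<and>
          wa1 E * y = 3 * x^2 + 2 * wa2 E * x + wa4 E)"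

datatype ec_point = Origin | Affine complex complex

instantiation ec_point :: projective
begin

definition coords_ec_point :: "ec_point \<Rightarrow> nat \<Rightarrow> complex" where
  "coords_ec_point p =
     (case p of Origin \<Rightarrow> (\<lambda>_. 0)(1 := 1)
      | Affine x y \<Rightarrow> (\<lambda>_. 0)(0 := x, 1 := y, 2 := 1))"

instance
proof
  fix p :: ec_point
  have "coords p 1 \<noteq> 0 \<or> coords p 2 \<noteq> 0"
    by (cases p) (simp_all add: coords_ec_point_def)
  then show "\<exists>i. coords p i \<noteq> 0"
    by blast
next
  fix p q :: ec_point and c :: complex
  assume h: "\<And>i. coords p i = c * coords q i"
  show "p = q"
    using h[of 0] h[of 1] h[of 2]
    by (cases p; cases q) (simp_all add: coords_ec_point_def)
qed

end

definition ec_points :: "weierstrass \<Rightarrow> ec_point set" where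
  "ec_points E = insert Origin {Affine x y | x y. weierstrass_eq E x y}"

text \<open>
  The chord-tangent law: \<open>l\<close> is the slope of the chord through the two points (of the tangent if
  they coincide), and the third point of intersection with this line is reflected by
  \<open>(x, y) \<mapsto> (x, - y - a\<^sub>1 x - a\<^sub>3)\<close>.
\<close>

fun ec_add :: "weierstrass \<Rightarrow> ec_point \<Rightarrow> ec_point \<Rightarrow> ec_point" where
  "ec_add E Origin Q = Q"
| "ec_add E P Origin = P"
| "ec_add E (Affine x1 y1) (Affine x2 y2) =
     (if x1 = x2 \<and> y1 + y2 + wa1 E * x2 + wa3 E = 0 then Origin
      else
        let l = (if x1 = x2
                 then (3 * x1^2 + 2 * wa2 E * x1 + wa4 E - wa1 E * y1) / (2 * y1 + wa1 E * x1 + wa3 E)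
                 else (y2 - y1) / (x2 - x1));
            x3 = l^2 + wa1 E * l - wa2 E - x1 - x2;
            y3 = y1 + l * (x3 - x1)
        in Affine x3 (- y3 - wa1 E * x3 - wa3 E))"

definition ec_group :: "weierstrass \<Rightarrow> ec_point monoid" where
  "ec_group E = \<lparr>carrier = ec_points E, monoid.mult = ec_add E, one = Origin\<rparr>"

definition isogeny :: "weierstrass \<Rightarrow> weierstrass \<Rightarrow> (ec_point \<Rightarrow> ec_point) \<Rightarrow> bool" where
  "isogeny E X \<psi> \<longleftrightarrow> morphism (ec_points E) (ec_points X) \<psi> \<and> \<psi> \<in> hom (ec_group E) (ec_group X)"


section \<open>Toroidal Belyi pairs\<close>

text \<open>
  Maps on a curve are total functions on \<^typ>\<open>ec_point\<close>; all notions below only depend on their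
  values on the points of the curve.
\<close>

definition toroidal_belyi_pair :: "weierstrass \<Rightarrow> (ec_point \<Rightarrow> proj_line) \<Rightarrow> bool" where
  "toroidal_belyi_pair E \<beta> \<longleftrightarrow> elliptic_curve E \<and> belyi_map (ec_points E) \<beta>"

definition quasi_critical_points :: "weierstrass \<Rightarrow> (ec_point \<Rightarrow> proj_line) \<Rightarrow> ec_point set" where
  "quasi_critical_points E \<beta> = {P\<in>ec_points E. \<beta> P \<in> zero_one_infty}"

definition imprimitive :: "weierstrass \<Rightarrow> (ec_point \<Rightarrow> proj_line) \<Rightarrow> bool" where
  "imprimitive E \<beta> \<longleftrightarrow>
     (\<exists>X \<psi> \<phi> \<gamma>. elliptic_curve X \<and> isogeny E X \<psi> \<and>
        morphism (ec_points X) (UNIV :: proj_line set) \<phi> \<and> dynamical_belyi_map \<gamma> \<and>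
        (\<forall>P\<in>ec_points E. \<beta> P = \<gamma> (\<phi> (\<psi> P))) \<and>
        (map_degree UNIV UNIV \<gamma> \<ge> 2 \<or> map_degree (ec_points E) (ec_points X) \<psi> \<ge> 2))"

text \<open>
  Isomorphism of Belyi pairs: an isomorphism of curves compatible with the two Belyi maps. It is not
  required to preserve the origin, so this is the coarsest of the usual notions.
\<close>

definition isomorphic_pairs ::
  "weierstrass \<times> (ec_point \<Rightarrow> proj_line) \<Rightarrow> weierstrass \<times> (ec_point \<Rightarrow> proj_line) \<Rightarrow> bool" where
  "isomorphic_pairs = (\<lambda>(E, \<beta>) (E', \<beta>').
     \<exists>f g. morphism (ec_points E) (ec_points E') f \<and> morphism (ec_points E') (ec_points E) g \<and>
       (\<forall>P\<in>ec_points E. g (f P) = P) \<and> (\<forall>P\<in>ec_points E'. f (g P) = P) \<and>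
       (\<forall>P\<in>ec_points E. \<beta> P = \<beta>' (f P)))"

end

(*
  Take E : y^2 = x^3 - x and phi = x^2 on E.  Since dx has zeros only at the points with y = 0, the
  function phi is ramified only over 0, 1 and infinity, and phi^{-1}{0, 1, infinity} is the group
  E[2].  E has an endomorphism psi of degree 2, which is everywhere unramified, so phi o psi^k is
  again a Belyi map, with quasi-critical set the subgroup psi^{-k}(E[2]) of order 4 * 2^k.  Different k
  give different orders, hence non-isomorphic pairs; for k >= 1 the pair is imprimitive with gamma = id.

  Unramified means here that uniformizers pull back to uniformizers, which is stable under
  composition; that psi is a homomorphism follows because it maps collinear triples to collinear triples.
*)
theory Submission
  imports Defs
begin

section \<open>Forms and morphisms\<close>

text \<open>The index is a definite description over exponents, and local rings are given by
  quotients of forms without any valuation. A Belyi map is constrained only away from the fibres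
  over 0, 1 and \<infinity>, where the index must be 1; so the proof works with generators of the
  maximal ideal throughout and computes no higher order. The exponent in the description is unique
  only if the maximal ideal is nonzero near the point, which is where limits of points of the curve
  enter. The curve is chosen for its endomorphism of degree 2. With \<open>w = y / x\<close> and
  \<open>u = 1 / x\<close> the equation becomes \<open>w^2 = x - u\<close>, \<open>x u = 1\<close>,
  and the endomorphism is \<open>(w^2, w (x + u))\<close> up to scaling. Membership, the
  homomorphism law and the fibres are all computed in \<open>w\<close> and \<open>u\<close>.\<close>

lemma form_mult': "form d F \<Longrightarrow> form e G \<Longrightarrow> n = d + e \<Longrightarrow> form n (\<lambda>v. F v * G v)"
  by (simp add: form_mult)

lemma form_cmult: "form d F \<Longrightarrow> form d (\<lambda>v. c * F v)"
  using form_mult[OF form_const[of c]] by fastforce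

lemma form_uminus: "form d F \<Longrightarrow> form d (\<lambda>v. - F v)"
  using form_cmult[of d F "-1"] by simp

lemma form_diff: "form d F \<Longrightarrow> form d G \<Longrightarrow> form d (\<lambda>v. F v - G v)"
  using form_add[OF _ form_uminus] by fastforce

lemma form_power: "form d F \<Longrightarrow> m = n * d \<Longrightarrow> form m (\<lambda>v. F v ^ n)"
proof (induction n arbitrary: m)
  case 0
  then show ?case by (simp add: form_const)
next
  case (Suc n)
  then show ?case by (auto intro: form_mult)
qed

text \<open>\<open>form_const\<close> gives constants only in degree 0; zero times a power of a
  variable reaches every degree.\<close>

lemma form_zero: "form d (\<lambda>v. 0)"
  using form_cmult[OF form_power[OF form_var refl], of d 0] by simp

lemmas form_intros = form_const form_var form_add form_diff form_uminus form_cmult form_mult' form_power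

text \<open>Homogeneity: this is what makes the vanishing of a form independent of the
  representative, and it produces the factors \<open>c ^ e\<close> in the composition and pullback
  arguments.\<close>

lemma form_scale: "form d F \<Longrightarrow> F (\<lambda>i. c * v i) = c ^ d * F v"
  by (induction rule: form.induct) (simp_all add: algebra_simps power_add)

lemma form_compose:
  assumes "form d F" and "\<And>i. form e (G i)"
  shows "form (e * d) (\<lambda>v. F (\<lambda>i. G i v))"
  using assms(1)
proof (induction rule: form.induct)
  case (form_const c)
  then show ?case by (simp add: form.form_const)
next
  case (form_var i)
  then show ?case using assms(2) by simp
next
  case (form_add d F G)
  then show ?case by (simp add: form.form_add)
next
  case (form_mult d F e G)
  then show ?case by (simp add: form.form_mult distrib_left)
qed

lemma form_tendsto:
  assumes "form d F" and "\<And>i. ((\<lambda>n. v n i) \<longlongrightarrow> w i) A"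
  shows "((\<lambda>n. F (v n)) \<longlongrightarrow> F w) A"
  using assms(1) by (induction rule: form.induct) (auto intro: tendsto_intros assms(2))

section \<open>Composition of morphisms and their local presentation\<close>

lemma morphismE:
  assumes "morphism S T f" and "P \<in> S"
  obtains d F i where "\<And>i. form d (F i)" and "F i (coords P) \<noteq> 0"
    and "\<And>Q. Q \<in> S \<Longrightarrow> \<exists>c. \<forall>i. F i (coords Q) = c * coords (f Q) i"
  using assms unfolding morphism_def by metis

lemma morphism_id: "morphism S S (\<lambda>P. P)"
  unfolding morphism_def
proof (intro conjI ballI)
  fix P :: 'a
  show "\<exists>d F. (\<forall>i. form d (F i)) \<and> (\<exists>i. F i (coords P) \<noteq> 0) \<and>
      (\<forall>Q\<in>S. \<exists>c. \<forall>i. F i (coords Q) = c * coords Q i)"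
    by (rule exI[of _ 1], rule exI[of _ "\<lambda>i v. v i"])
      (use coords_nonzero[of P] in \<open>auto intro: form_var[simplified] exI[of _ 1]\<close>)
qed auto

text \<open>The forms of \<open>f\<close> are substituted into those of \<open>g\<close>. At
  \<open>P\<close> the factor \<open>c\<close> is nonzero because some \<open>F i\<close> does not
  vanish there, so by homogeneity the substituted form is a nonzero multiple of \<open>G j\<close>
  at \<open>f P\<close>.\<close>

lemma morphism_compose:
  assumes f: "morphism S T f" and g: "morphism T U g"
  shows "morphism S U (\<lambda>P. g (f P))"
  unfolding morphism_def
proof (intro conjI ballI)
  have "f ` S \<subseteq> T" "g ` T \<subseteq> U"
    using f g unfolding morphism_def by simp_all
  then show "(\<lambda>P. g (f P)) ` S \<subseteq> U"
    by auto
next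
  fix P assume P: "P \<in> S"
  have fS: "f Q \<in> T" if "Q \<in> S" for Q
    using f that unfolding morphism_def by auto
  obtain d F i where F: "\<And>i. form d (F i)" "F i (coords P) \<noteq> 0"
    "\<And>Q. Q \<in> S \<Longrightarrow> \<exists>c. \<forall>i. F i (coords Q) = c * coords (f Q) i"
    using morphismE[OF f P] by blast
  obtain e G j where G: "\<And>i. form e (G i)" "G j (coords (f P)) \<noteq> 0"
    "\<And>Q. Q \<in> T \<Longrightarrow> \<exists>c. \<forall>i. G i (coords Q) = c * coords (g Q) i"
    using morphismE[OF g fS[OF P]] by blast
  have eq: "G k (\<lambda>i. F i (coords Q)) = c ^ e * G k (coords (f Q))"
    if "\<forall>i. F i (coords Q) = c * coords (f Q) i" for k Q c
    using form_scale[OF G(1), of k c "coords (f Q)"] that by simp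
  show "\<exists>d F. (\<forall>i. form d (F i)) \<and> (\<exists>i. F i (coords P) \<noteq> 0) \<and>
      (\<forall>Q\<in>S. \<exists>c. \<forall>i. F i (coords Q) = c * coords (g (f Q)) i)"
  proof (rule exI[of _ "d * e"], rule exI[of _ "\<lambda>k v. G k (\<lambda>i. F i v)"], intro conjI allI ballI)
    show "form (d * e) (\<lambda>v. G k (\<lambda>i. F i v))" for k
      by (rule form_compose[OF G(1) F(1)])
    obtain c where c: "\<forall>i. F i (coords P) = c * coords (f P) i"
      using F(3)[OF P] by blast
    then have "c \<noteq> 0" using F(2) by auto
    then show "\<exists>j. G j (\<lambda>i. F i (coords P)) \<noteq> 0"
      using eq[OF c] G(2) by (intro exI[of _ j]) simp
  next
    fix Q assume Q: "Q \<in> S"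
    obtain c where c: "\<forall>i. F i (coords Q) = c * coords (f Q) i"
      using F(3)[OF Q] by blast
    obtain c' where c': "\<forall>i. G i (coords (f Q)) = c' * coords (g (f Q)) i"
      using G(3)[OF fS[OF Q]] by blast
    show "\<exists>c. \<forall>k. G k (\<lambda>i. F i (coords Q)) = c * coords (g (f Q)) k"
      by (rule exI[of _ "c ^ e * c'"]) (use eq[OF c] c' in simp)
  qed
qed

text \<open>Points of \<open>proj_line\<close> and \<open>ec_point\<close> have zero coordinates
  from index 3 on, so the infinite family in \<open>morphism\<close> reduces to an explicit triple.
  The point \<open>P\<close> enters only in the nonvanishing clause.\<close>

definition given_by :: "'a::projective set \<Rightarrow> ('a \<Rightarrow> 'b::projective) \<Rightarrow> 'a \<Rightarrow> nat \<Rightarrow>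
    ((nat \<Rightarrow> complex) \<Rightarrow> complex) \<Rightarrow> ((nat \<Rightarrow> complex) \<Rightarrow> complex) \<Rightarrow> ((nat \<Rightarrow> complex) \<Rightarrow> complex) \<Rightarrow> bool" where
  "given_by S f P d A B C \<longleftrightarrow> form d A \<and> form d B \<and> form d C \<and>
     (A (coords P) \<noteq> 0 \<or> B (coords P) \<noteq> 0 \<or> C (coords P) \<noteq> 0) \<and>
     (\<forall>Q\<in>S. \<exists>c. A (coords Q) = c * coords (f Q) 0 \<and> B (coords Q) = c * coords (f Q) 1 \<and>
        C (coords Q) = c * coords (f Q) 2)"

lemma morphismI:
  assumes "\<And>P. P \<in> S \<Longrightarrow> f P \<in> T"
    and "\<And>P k. P \<in> S \<Longrightarrow> 3 \<le> k \<Longrightarrow> coords (f P) k = 0"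
    and "\<And>P. P \<in> S \<Longrightarrow> \<exists>d A B C. given_by S f P d A B C"
  shows "morphism S T f"
  unfolding morphism_def
proof (intro conjI ballI)
  show "f ` S \<subseteq> T" using assms(1) by blast
next
  fix P assume P: "P \<in> S"
  obtain d A B C where *: "form d A" "form d B" "form d C"
    "A (coords P) \<noteq> 0 \<or> B (coords P) \<noteq> 0 \<or> C (coords P) \<noteq> 0"
    "\<And>Q. Q \<in> S \<Longrightarrow> \<exists>c. A (coords Q) = c * coords (f Q) 0 \<and> B (coords Q) = c * coords (f Q) 1 \<and>
         C (coords Q) = c * coords (f Q) 2"
    using assms(3)[OF P] unfolding given_by_def by blast
  define F where "F k = (if k = 0 then A else if k = 1 then B else if k = 2 then C else (\<lambda>v. 0))"
    for k :: nat
  have "form d (F k)" for k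
    using * form_zero by (simp add: F_def)
  moreover have "F 0 = A" "F 1 = B" "F 2 = C"
    by (simp_all add: F_def)
  then have "\<exists>k. F k (coords P) \<noteq> 0"
    using *(4) by metis
  moreover have "\<exists>c. \<forall>k. F k (coords Q) = c * coords (f Q) k" if Q: "Q \<in> S" for Q
  proof -
    obtain c where c: "A (coords Q) = c * coords (f Q) 0" "B (coords Q) = c * coords (f Q) 1"
      "C (coords Q) = c * coords (f Q) 2"
      using *(5)[OF Q] by blast
    have "F k (coords Q) = c * coords (f Q) k" for k
      using c assms(2)[OF Q, of k] by (cases "3 \<le> k") (auto simp: F_def not_le less_Suc_eq numeral_3_eq_3)
    then show ?thesis by blast
  qed
  ultimately show "\<exists>d F. (\<forall>i. form d (F i)) \<and> (\<exists>i. F i (coords P) \<noteq> 0) \<and>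
      (\<forall>Q\<in>S. \<exists>c. \<forall>i. F i (coords Q) = c * coords (f Q) i)"
    by blast
qed

section \<open>Local rings\<close>

lemma zariski_nearI:
  "form d H \<Longrightarrow> H (coords P) \<noteq> 0 \<Longrightarrow> (\<And>Q. Q \<in> S \<Longrightarrow> H (coords Q) \<noteq> 0 \<Longrightarrow> R Q) \<Longrightarrow> zariski_near S P R"
  unfolding zariski_near_def by blast

lemma zariski_nearD: "zariski_near S P R \<Longrightarrow> P \<in> S \<Longrightarrow> R P"
  unfolding zariski_near_def by blast

lemma zariski_near_mono:
  "zariski_near S P R \<Longrightarrow> (\<And>Q. Q \<in> S \<Longrightarrow> R Q \<Longrightarrow> R' Q) \<Longrightarrow> zariski_near S P R'"
  unfolding zariski_near_def by blast

lemma zariski_near_conj: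
  assumes "zariski_near S P R" and "zariski_near S P R'"
  shows "zariski_near S P (\<lambda>Q. R Q \<and> R' Q)"
proof -
  obtain d H where H: "form d H" "H (coords P) \<noteq> 0" "\<forall>Q\<in>S. H (coords Q) \<noteq> 0 \<longrightarrow> R Q"
    using assms(1) unfolding zariski_near_def by blast
  obtain d' H' where H': "form d' H'" "H' (coords P) \<noteq> 0" "\<forall>Q\<in>S. H' (coords Q) \<noteq> 0 \<longrightarrow> R' Q"
    using assms(2) unfolding zariski_near_def by blast
  show ?thesis
    by (rule zariski_nearI[OF form_mult[OF H(1) H'(1)]]) (use H H' in auto)
qed

lemma zariski_near_mono2:
  "zariski_near S P R \<Longrightarrow> zariski_near S P R' \<Longrightarrow> (\<And>Q. Q \<in> S \<Longrightarrow> R Q \<Longrightarrow> R' Q \<Longrightarrow> R'' Q) \<Longrightarrow>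
    zariski_near S P R''"
  by (rule zariski_near_mono[OF zariski_near_conj[of S P R R']]) auto

lemma zariski_near_always: "(\<And>Q. Q \<in> S \<Longrightarrow> R Q) \<Longrightarrow> zariski_near S P R"
  by (rule zariski_nearI[OF form_const[of 1]]) auto

lemma zariski_near_coord: "coords P j \<noteq> 0 \<Longrightarrow> zariski_near S P (\<lambda>Q. coords Q j \<noteq> 0)"
  by (rule zariski_nearI[OF form_var[of j]]) auto

lemma regular_at_ratio:
  "form d F \<Longrightarrow> form d G \<Longrightarrow> G (coords P) \<noteq> 0 \<Longrightarrow> regular_at S P (\<lambda>Q. F (coords Q) / G (coords Q))"
  unfolding regular_at_def by (blast intro: zariski_near_always)

lemma regular_at_coord: "coords P j \<noteq> 0 \<Longrightarrow> regular_at S P (\<lambda>Q. coords Q i / coords Q j)"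
  by (rule regular_at_ratio[OF form_var[of i] form_var[of j]])

lemma regular_at_cong:
  assumes "regular_at S P g" and "zariski_near S P (\<lambda>Q. h Q = g Q)"
  shows "regular_at S P h"
proof -
  obtain d F G where "form d F" "form d G" "G (coords P) \<noteq> 0"
    "zariski_near S P (\<lambda>Q. g Q = F (coords Q) / G (coords Q))"
    using assms(1) unfolding regular_at_def by blast
  then show ?thesis
    unfolding regular_at_def using zariski_near_mono2[OF assms(2)] by (metis (no_types, lifting))
qed

text \<open>Recording that the denominator is nonzero on the same neighbourhood allows fractions to
  be cleared there.\<close>

lemma regular_atE:
  assumes "regular_at S P g"
  obtains d F G where "form d F" and "form d G" and "G (coords P) \<noteq> 0"
    and "zariski_near S P (\<lambda>Q. g Q = F (coords Q) / G (coords Q) \<and> G (coords Q) \<noteq> 0)"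
proof -
  obtain d F G where *: "form d F" "form d G" "G (coords P) \<noteq> 0"
    "zariski_near S P (\<lambda>Q. g Q = F (coords Q) / G (coords Q))"
    using assms unfolding regular_at_def by blast
  moreover have "zariski_near S P (\<lambda>Q. G (coords Q) \<noteq> 0)"
    by (rule zariski_nearI[OF *(2,3)])
  ultimately show thesis
    using that zariski_near_conj by blast
qed

lemma regular_at_const: "regular_at S P (\<lambda>Q. c)"
  using regular_at_ratio[OF form_const[of c] form_const[of 1], where S = S and P = P] by simp

lemma regular_at_add:
  assumes "regular_at S P g" and "regular_at S P h"
  shows "regular_at S P (\<lambda>Q. g Q + h Q)"
proof -
  obtain d F G where 1: "form d F" "form d G" "G (coords P) \<noteq> 0"
    "zariski_near S P (\<lambda>Q. g Q = F (coords Q) / G (coords Q) \<and> G (coords Q) \<noteq> 0)"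
    using regular_atE[OF assms(1)] by blast
  obtain e F' G' where 2: "form e F'" "form e G'" "G' (coords P) \<noteq> 0"
    "zariski_near S P (\<lambda>Q. h Q = F' (coords Q) / G' (coords Q) \<and> G' (coords Q) \<noteq> 0)"
    using regular_atE[OF assms(2)] by blast
  have "regular_at S P (\<lambda>Q. (F (coords Q) * G' (coords Q) + G (coords Q) * F' (coords Q)) /
      (G (coords Q) * G' (coords Q)))"
    by (rule regular_at_ratio[of "d + e" "\<lambda>v. F v * G' v + G v * F' v" "\<lambda>v. G v * G' v"])
      (use 1 2 in \<open>auto intro: form_mult form_add\<close>)
  then show ?thesis
    by (rule regular_at_cong) (rule zariski_near_mono2[OF 1(4) 2(4)], simp add: field_simps)
qed

lemma regular_at_mult:
  assumes "regular_at S P g" and "regular_at S P h"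
  shows "regular_at S P (\<lambda>Q. g Q * h Q)"
proof -
  obtain d F G where 1: "form d F" "form d G" "G (coords P) \<noteq> 0"
    "zariski_near S P (\<lambda>Q. g Q = F (coords Q) / G (coords Q) \<and> G (coords Q) \<noteq> 0)"
    using regular_atE[OF assms(1)] by blast
  obtain e F' G' where 2: "form e F'" "form e G'" "G' (coords P) \<noteq> 0"
    "zariski_near S P (\<lambda>Q. h Q = F' (coords Q) / G' (coords Q) \<and> G' (coords Q) \<noteq> 0)"
    using regular_atE[OF assms(2)] by blast
  have "regular_at S P (\<lambda>Q. (F (coords Q) * F' (coords Q)) / (G (coords Q) * G' (coords Q)))"
    by (rule regular_at_ratio[of "d + e" "\<lambda>v. F v * F' v" "\<lambda>v. G v * G' v"])
      (use 1 2 in \<open>auto intro: form_mult\<close>)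
  then show ?thesis
    by (rule regular_at_cong) (rule zariski_near_mono2[OF 1(4) 2(4)], simp)
qed

lemma regular_at_power: "regular_at S P g \<Longrightarrow> regular_at S P (\<lambda>Q. g Q ^ n)"
  by (induction n) (auto intro: regular_at_mult regular_at_const)

lemma regular_at_uminus: "regular_at S P g \<Longrightarrow> regular_at S P (\<lambda>Q. - g Q)"
  using regular_at_mult[OF regular_at_const[of S P "-1"]] by fastforce

lemma regular_at_diff:
  "regular_at S P g \<Longrightarrow> regular_at S P h \<Longrightarrow> regular_at S P (\<lambda>Q. g Q - h Q)"
  using regular_at_add[OF _ regular_at_uminus] by fastforce

lemma regular_at_nonzero_near:
  assumes "P \<in> S" and "regular_at S P g" and "g P \<noteq> 0"
  shows "zariski_near S P (\<lambda>Q. g Q \<noteq> 0)"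
proof -
  obtain d F G where 1: "form d F" "form d G" "G (coords P) \<noteq> 0"
    "zariski_near S P (\<lambda>Q. g Q = F (coords Q) / G (coords Q) \<and> G (coords Q) \<noteq> 0)"
    using regular_atE[OF assms(2)] by blast
  have "F (coords P) \<noteq> 0"
    using zariski_nearD[OF 1(4) assms(1)] assms(3) by auto
  then have "zariski_near S P (\<lambda>Q. F (coords Q) \<noteq> 0)"
    by (rule zariski_nearI[OF 1(1)])
  then show ?thesis
    by (rule zariski_near_mono2[OF 1(4)]) auto
qed

text \<open>Germs that are nonzero at \<open>P\<close> are units: exchange numerator and denominator
  of a presenting fraction.\<close>

lemma regular_at_divide:
  assumes "P \<in> S" and "regular_at S P h" and "regular_at S P g" and "g P \<noteq> 0"
  shows "regular_at S P (\<lambda>Q. h Q / g Q)"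
proof -
  obtain d F G where 1: "form d F" "form d G" "G (coords P) \<noteq> 0"
    "zariski_near S P (\<lambda>Q. g Q = F (coords Q) / G (coords Q) \<and> G (coords Q) \<noteq> 0)"
    using regular_atE[OF assms(3)] by blast
  have "F (coords P) \<noteq> 0"
    using zariski_nearD[OF 1(4) assms(1)] assms(4) by auto
  then have "regular_at S P (\<lambda>Q. G (coords Q) / F (coords Q))"
    by (rule regular_at_ratio[OF 1(2,1)])
  from regular_at_mult[OF assms(2) this] show ?thesis
    by (rule regular_at_cong) (rule zariski_near_mono[OF 1(4)], simp)
qed

lemmas regular_intros = regular_at_coord regular_at_const regular_at_add regular_at_diff
  regular_at_uminus regular_at_mult regular_at_power regular_at_divide

section \<open>Pullback of neighbourhoods and germs along a morphism\<close>

lemma zariski_near_pullback: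
  assumes "morphism S T f" and "P \<in> S" and "zariski_near T (f P) R"
  shows "zariski_near S P (\<lambda>Q. R (f Q))"
proof -
  obtain d F i where F: "\<And>i. form d (F i)" "F i (coords P) \<noteq> 0"
    "\<And>Q. Q \<in> S \<Longrightarrow> \<exists>c. \<forall>i. F i (coords Q) = c * coords (f Q) i"
    using morphismE[OF assms(1,2)] by blast
  obtain e H where H: "form e H" "H (coords (f P)) \<noteq> 0" "\<forall>Q\<in>T. H (coords Q) \<noteq> 0 \<longrightarrow> R Q"
    using assms(3) unfolding zariski_near_def by blast
  have eq: "\<exists>c. (\<forall>i. F i (coords Q) = c * coords (f Q) i) \<and>
      H (\<lambda>i. F i (coords Q)) = c ^ e * H (coords (f Q))" if "Q \<in> S" for Q
    using F(3)[OF that] form_scale[OF H(1), of _ "coords (f Q)"] by fastforce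
  show ?thesis
  proof (rule zariski_nearI[OF form_compose[OF H(1) F(1)]])
    show "H (\<lambda>i. F i (coords P)) \<noteq> 0"
      using eq[OF assms(2)] F(2) H(2) by auto
    show "R (f Q)" if "Q \<in> S" "H (\<lambda>i. F i (coords Q)) \<noteq> 0" for Q
      using eq[OF that(1)] that H(3) assms(1) unfolding morphism_def by auto
  qed
qed

lemma regular_at_pullback:
  assumes "morphism S T f" and "P \<in> S" and "regular_at T (f P) g"
  shows "regular_at S P (\<lambda>Q. g (f Q))"
proof -
  obtain e G H where G: "form e G" "form e H" "H (coords (f P)) \<noteq> 0"
    "zariski_near T (f P) (\<lambda>Q. g Q = G (coords Q) / H (coords Q) \<and> H (coords Q) \<noteq> 0)"
    using regular_atE[OF assms(3)] by blast
  obtain d F i where F: "\<And>i. form d (F i)" "F i (coords P) \<noteq> 0"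
    "\<And>Q. Q \<in> S \<Longrightarrow> \<exists>c. \<forall>i. F i (coords Q) = c * coords (f Q) i"
    using morphismE[OF assms(1,2)] by blast
  have eq: "\<exists>c. (\<forall>i. F i (coords Q) = c * coords (f Q) i) \<and>
      G (\<lambda>i. F i (coords Q)) = c ^ e * G (coords (f Q)) \<and>
      H (\<lambda>i. F i (coords Q)) = c ^ e * H (coords (f Q))" if "Q \<in> S" for Q
    using F(3)[OF that] form_scale[OF G(1), of _ "coords (f Q)"]
      form_scale[OF G(2), of _ "coords (f Q)"] by fastforce
  have "regular_at S P (\<lambda>Q. G (\<lambda>i. F i (coords Q)) / H (\<lambda>i. F i (coords Q)))"
    by (rule regular_at_ratio[OF form_compose[OF G(1) F(1)] form_compose[OF G(2) F(1)]])
      (use eq[OF assms(2)] F(2) G(3) in auto)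
  moreover have "zariski_near S P (\<lambda>Q. F i (coords Q) \<noteq> 0)"
    by (rule zariski_nearI[OF F(1,2)])
  then have "zariski_near S P (\<lambda>Q. g (f Q) = G (\<lambda>i. F i (coords Q)) / H (\<lambda>i. F i (coords Q)))"
  proof (rule zariski_near_mono2[OF zariski_near_pullback[OF assms(1,2) G(4)]])
    fix Q assume Q: "Q \<in> S" "g (f Q) = G (coords (f Q)) / H (coords (f Q)) \<and> H (coords (f Q)) \<noteq> 0"
      "F i (coords Q) \<noteq> 0"
    then show "g (f Q) = G (\<lambda>i. F i (coords Q)) / H (\<lambda>i. F i (coords Q))"
      using eq[OF Q(1)] by auto
  qed
  ultimately show ?thesis
    by (rule regular_at_cong)
qed

section \<open>Uniformizers and unramified morphisms\<close>

lemma uniformizerD: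
  assumes "uniformizer S P \<pi>"
  shows "regular_at S P \<pi>" and "\<pi> P = 0"
    and "\<And>g. regular_at S P g \<Longrightarrow> g P = 0 \<Longrightarrow>
      \<exists>h. regular_at S P h \<and> zariski_near S P (\<lambda>Q. g Q = h Q * \<pi> Q)"
  using assms unfolding uniformizer_def by auto

text \<open>If the generator \<pi> of the maximal ideal is a multiple of \<pi>', and \<pi>' lies in
  that ideal, then \<pi>' generates it too.\<close>

lemma uniformizer_divisor:
  assumes "uniformizer S P \<pi>" and "regular_at S P \<pi>'" and "\<pi>' P = 0"
    and "regular_at S P h" and "zariski_near S P (\<lambda>Q. \<pi> Q = h Q * \<pi>' Q)"
  shows "uniformizer S P \<pi>'"
  unfolding uniformizer_def
proof (intro conjI allI impI)
  fix g assume "regular_at S P g \<and> g P = 0"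
  then obtain k where k: "regular_at S P k" "zariski_near S P (\<lambda>Q. g Q = k Q * \<pi> Q)"
    using uniformizerD(3)[OF assms(1)] by blast
  show "\<exists>h. regular_at S P h \<and> zariski_near S P (\<lambda>Q. g Q = h Q * \<pi>' Q)"
    by (rule exI[of _ "\<lambda>Q. k Q * h Q"])
      (use regular_at_mult[OF k(1) assms(4)] zariski_near_mono2[OF k(2) assms(5)] in simp)
qed (use assms in auto)

lemma uniformizer_unit_multiple:
  assumes "uniformizer S P \<pi>" and "P \<in> S" and "regular_at S P u" and "u P \<noteq> 0"
    and "zariski_near S P (\<lambda>Q. \<pi>' Q = u Q * \<pi> Q)"
  shows "uniformizer S P \<pi>'"
proof (rule uniformizer_divisor[OF assms(1)])
  show "regular_at S P \<pi>'"
    by (rule regular_at_cong[OF regular_at_mult[OF assms(3) uniformizerD(1)[OF assms(1)]] assms(5)])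
  show "\<pi>' P = 0"
    using zariski_nearD[OF assms(5,2)] uniformizerD(2)[OF assms(1)] by simp
  show "regular_at S P (\<lambda>Q. 1 / u Q)"
    using assms(2-4) by (intro regular_intros)
  show "zariski_near S P (\<lambda>Q. \<pi> Q = 1 / u Q * \<pi>' Q)"
    by (rule zariski_near_mono2[OF regular_at_nonzero_near[OF assms(2-4)] assms(5)]) simp
qed

text \<open>The maximal ideal at \<open>P\<close> is generated by the affine coordinates centred at \<open>P\<close>.\<close>

lemma uniformizerI:
  assumes P: "P \<in> S" and j: "coords P j \<noteq> 0" and \<pi>: "regular_at S P \<pi>" "\<pi> P = 0"
    and gen: "\<And>i. \<exists>h. regular_at S P h \<and>
      zariski_near S P (\<lambda>Q. coords Q i / coords Q j - coords P i / coords P j = h Q * \<pi> Q)"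
  shows "uniformizer S P \<pi>"
proof -
  \<comment> \<open>Division by a power of the \<open>j\<close>-th coordinate turns a form into a
    polynomial in the affine coordinates. Induction over \<open>form\<close> carries divisibility by
    \<pi> from the coordinates to all forms; products use
    \<open>FG - F0 G0 = (F - F0) G + F0 (G - G0)\<close>.\<close>
  have key: "regular_at S P (\<lambda>Q. F (coords Q) / coords Q j ^ d) \<and> (\<exists>h. regular_at S P h \<and>
      zariski_near S P (\<lambda>Q. F (coords Q) / coords Q j ^ d - F (coords P) / coords P j ^ d = h Q * \<pi> Q))"
    if "form d F" for d F
    using that
  proof (induction rule: form.induct)
    case (form_const c)
    then show ?case
      by (auto intro!: regular_at_const exI[of _ "\<lambda>_. 0"] zariski_near_always)
  next
    case (form_var i)
    then show ?case
      using gen[of i] regular_at_coord[OF j, of S i] by simp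
  next
    case (form_add d F G)
    then obtain h k where h: "regular_at S P h" "regular_at S P k"
      "zariski_near S P (\<lambda>Q. F (coords Q) / coords Q j ^ d - F (coords P) / coords P j ^ d = h Q * \<pi> Q)"
      "zariski_near S P (\<lambda>Q. G (coords Q) / coords Q j ^ d - G (coords P) / coords P j ^ d = k Q * \<pi> Q)"
      by blast
    have "zariski_near S P (\<lambda>Q. (F (coords Q) + G (coords Q)) / coords Q j ^ d -
        (F (coords P) + G (coords P)) / coords P j ^ d = (h Q + k Q) * \<pi> Q)"
      by (rule zariski_near_mono2[OF h(3,4)])
        (simp only: add_divide_distrib distrib_right add_diff_add)
    moreover have "regular_at S P (\<lambda>Q. (F (coords Q) + G (coords Q)) / coords Q j ^ d)"
      using form_add.IH by (simp add: add_divide_distrib regular_at_add)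
    ultimately show ?case
      using regular_at_add[OF h(1,2)] by (auto intro!: exI[of _ "\<lambda>Q. h Q + k Q"])
  next
    case (form_mult d F e G)
    then obtain h k where h: "regular_at S P h" "regular_at S P k"
      "zariski_near S P (\<lambda>Q. F (coords Q) / coords Q j ^ d - F (coords P) / coords P j ^ d = h Q * \<pi> Q)"
      "zariski_near S P (\<lambda>Q. G (coords Q) / coords Q j ^ e - G (coords P) / coords P j ^ e = k Q * \<pi> Q)"
      by blast
    let ?F = "\<lambda>Q. F (coords Q) / coords Q j ^ d" and ?G = "\<lambda>Q. G (coords Q) / coords Q j ^ e"
    have eq: "F (coords Q) * G (coords Q) / coords Q j ^ (d + e) = ?F Q * ?G Q" for Q
      by (simp add: power_add)
    have "zariski_near S P (\<lambda>Q. ?F Q * ?G Q - ?F P * ?G P = (h Q * ?G Q + ?F P * k Q) * \<pi> Q)"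
    proof (rule zariski_near_mono2[OF h(3,4)])
      fix Q assume a: "?F Q - ?F P = h Q * \<pi> Q" "?G Q - ?G P = k Q * \<pi> Q"
      have "?F Q * ?G Q - ?F P * ?G P = (?F Q - ?F P) * ?G Q + ?F P * (?G Q - ?G P)"
        by (simp add: algebra_simps)
      then show "?F Q * ?G Q - ?F P * ?G P = (h Q * ?G Q + ?F P * k Q) * \<pi> Q"
        unfolding a by (simp only: algebra_simps)
    qed
    moreover note reg = form_mult.IH[THEN conjunct1]
    moreover have "regular_at S P (\<lambda>Q. ?F Q * ?G Q)"
      using reg by (rule regular_at_mult)
    moreover have "regular_at S P (\<lambda>Q. h Q * ?G Q + ?F P * k Q)"
      by (intro regular_at_add regular_at_mult regular_at_const h(1,2) reg)
    ultimately show ?case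
      unfolding eq by blast
  qed
  show ?thesis
    unfolding uniformizer_def
  proof (intro conjI allI impI)
    fix g assume g: "regular_at S P g \<and> g P = 0"
    then obtain d F G where F: "form d F" "form d G" "G (coords P) \<noteq> 0"
      "zariski_near S P (\<lambda>Q. g Q = F (coords Q) / G (coords Q) \<and> G (coords Q) \<noteq> 0)"
      by (blast elim: regular_atE)
    have F0: "F (coords P) = 0"
      using zariski_nearD[OF F(4) P] g by auto
    obtain h where h: "regular_at S P h"
      "zariski_near S P (\<lambda>Q. F (coords Q) / coords Q j ^ d - F (coords P) / coords P j ^ d = h Q * \<pi> Q)"
      using key[OF F(1)] by blast
    \<comment> \<open>Numerator and denominator of \<open>g\<close> are both dehomogenised: the
      first is a multiple of \<pi> because \<open>F\<close> vanishes at \<open>P\<close>, the second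
      is a unit.\<close>
    have "regular_at S P (\<lambda>Q. h Q / (G (coords Q) / coords Q j ^ d))"
      by (rule regular_at_divide[OF P h(1) key[OF F(2), THEN conjunct1]]) (use F(3) j in simp)
    moreover have "zariski_near S P (\<lambda>Q. g Q = h Q / (G (coords Q) / coords Q j ^ d) * \<pi> Q)"
      by (rule zariski_near_mono2[OF zariski_near_conj[OF F(4) zariski_near_coord[OF j]] h(2)])
        (simp add: F0 field_simps)
    ultimately show "\<exists>h. regular_at S P h \<and> zariski_near S P (\<lambda>Q. g Q = h Q * \<pi> Q)"
      by blast
  qed (use \<pi> in auto)
qed

definition unramified_at :: "'a::projective set \<Rightarrow> 'b::projective set \<Rightarrow> ('a \<Rightarrow> 'b) \<Rightarrow> 'a \<Rightarrow> bool" where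
  "unramified_at S T f P \<longleftrightarrow> (\<forall>t. uniformizer T (f P) t \<longrightarrow> uniformizer S P (\<lambda>Q. t (f Q)))"

text \<open>Any other uniformizer \<open>s\<close> at \<open>f P\<close> divides \<open>t\<close>,
  so its pullback divides the uniformizer obtained from \<open>t\<close>. Hence testing a single
  uniformizer is enough.\<close>

lemma unramified_atI:
  assumes "morphism S T f" and "P \<in> S" and "uniformizer T (f P) t" and "uniformizer S P (\<lambda>Q. t (f Q))"
  shows "unramified_at S T f P"
  unfolding unramified_at_def
proof (intro allI impI)
  fix s assume s: "uniformizer T (f P) s"
  obtain a where a: "regular_at T (f P) a" "zariski_near T (f P) (\<lambda>Q. t Q = a Q * s Q)"
    using uniformizerD(3)[OF s uniformizerD(1,2)[OF assms(3)]] by blast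
  show "uniformizer S P (\<lambda>Q. s (f Q))"
    by (rule uniformizer_divisor[OF assms(4) _ _ regular_at_pullback[OF assms(1,2) a(1)]
          zariski_near_pullback[OF assms(1,2) a(2)]])
      (use uniformizerD[OF s] regular_at_pullback[OF assms(1,2)] in auto)
qed

lemma unramified_at_compose:
  "unramified_at S T f P \<Longrightarrow> unramified_at T U g (f P) \<Longrightarrow> unramified_at S U (\<lambda>Q. g (f Q)) P"
  unfolding unramified_at_def by auto

lemma unramified_at_id: "unramified_at S S (\<lambda>Q. Q) P"
  unfolding unramified_at_def by auto

text \<open>
  The function \<open>g\<close> witnesses that \<open>P\<close> is not isolated; otherwise \<open>\<pi> = 0\<close> near \<open>P\<close> and the exponent
  defining the ramification index would not be unique.
\<close>

lemma ramification_index_unramified: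
  assumes f: "morphism S T f" and P: "P \<in> S" and t0: "uniformizer T (f P) t0"
    and unr: "unramified_at S T f P"
    and g: "regular_at S P g" "g P = 0" "\<not> zariski_near S P (\<lambda>Q. g Q = 0)"
  shows "ramification_index S T f P = 1"
  unfolding ramification_index_def
proof (rule the_equality)
  let ?p = "\<lambda>Q. t0 (f Q)"
  have p: "uniformizer S P ?p"
    using unr t0 unfolding unramified_at_def by blast
  show "\<exists>t \<pi> u. uniformizer T (f P) t \<and> uniformizer S P \<pi> \<and> regular_at S P u \<and> u P \<noteq> 0 \<and>
      zariski_near S P (\<lambda>Q. t (f Q) = u Q * \<pi> Q ^ 1)"
    by (rule exI[of _ t0], rule exI[of _ ?p], rule exI[of _ "\<lambda>_. 1"])
      (use t0 p in \<open>auto intro: regular_at_const zariski_near_always\<close>)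
  fix n
  assume "\<exists>t \<pi> u. uniformizer T (f P) t \<and> uniformizer S P \<pi> \<and> regular_at S P u \<and> u P \<noteq> 0 \<and>
      zariski_near S P (\<lambda>Q. t (f Q) = u Q * \<pi> Q ^ n)"
  then obtain t \<pi> u where t: "uniformizer T (f P) t" and \<pi>: "uniformizer S P \<pi>"
    and u: "regular_at S P u" "u P \<noteq> 0" "zariski_near S P (\<lambda>Q. t (f Q) = u Q * \<pi> Q ^ n)"
    by blast
  \<comment> \<open>Exponent 0 would make the pullback of \<open>t\<close> a unit, but it vanishes
    at \<open>P\<close>.\<close>
  have "n \<noteq> 0"
    using zariski_nearD[OF u(3) P] u(2) uniformizerD(2)[OF t] by auto
  moreover have False if n: "n \<ge> 2"
  proof -
    obtain a where a: "regular_at T (f P) a" "zariski_near T (f P) (\<lambda>Q. t0 Q = a Q * t Q)"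
      using uniformizerD(3)[OF t uniformizerD(1,2)[OF t0]] by blast
    obtain b where b: "regular_at S P b" "zariski_near S P (\<lambda>Q. \<pi> Q = b Q * ?p Q)"
      using uniformizerD(3)[OF p uniformizerD(1,2)[OF \<pi>]] by blast
    \<comment> \<open>Following \<open>t0\<close> to \<open>t\<close>, then to \<pi>, then back to
      \<open>?p\<close> gives \<open>?p = a u b^n ?p^n\<close>, that is \<open>?p * w = 0\<close>.
      For \<open>n \<ge> 2\<close> the value of \<open>w\<close> at \<open>P\<close> is 1, so
      \<open>w\<close> is a unit and \<open>?p\<close> vanishes near \<open>P\<close>, and with it
      every multiple, among them \<open>g\<close>.\<close>
    define w where "w = (\<lambda>Q. 1 - a (f Q) * u Q * b Q ^ n * ?p Q ^ (n - 1))"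
    have "regular_at S P w"
      unfolding w_def
      by (intro regular_intros regular_at_pullback[OF f P] a u b uniformizerD(1)[OF t0])
    moreover have "w P = 1"
      using n uniformizerD(2)[OF t0] by (simp add: w_def)
    ultimately have w: "zariski_near S P (\<lambda>Q. w Q \<noteq> 0)"
      by (intro regular_at_nonzero_near[OF P]) auto
    have "zariski_near S P (\<lambda>Q. ?p Q * w Q = 0)"
    proof (rule zariski_near_mono2[OF zariski_near_pullback[OF f P a(2)] zariski_near_conj[OF b(2) u(3)]])
      fix Q assume h: "t0 (f Q) = a (f Q) * t (f Q)" "\<pi> Q = b Q * t0 (f Q) \<and> t (f Q) = u Q * \<pi> Q ^ n"
      have "?p Q * ?p Q ^ (n - 1) = ?p Q ^ n"
        using n by (simp flip: power_Suc)
      then have "?p Q * w Q = ?p Q - a (f Q) * (u Q * (b Q * ?p Q) ^ n)"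
        unfolding w_def by (simp add: algebra_simps power_mult_distrib)
      also have "u Q * (b Q * ?p Q) ^ n = t (f Q)"
        using h(2) by metis
      also have "a (f Q) * t (f Q) = ?p Q"
        by (rule h(1)[symmetric])
      finally show "?p Q * w Q = 0"
        by simp
    qed
    then have "zariski_near S P (\<lambda>Q. ?p Q = 0)"
      by (rule zariski_near_mono2[OF w]) simp
    moreover obtain h where "zariski_near S P (\<lambda>Q. g Q = h Q * ?p Q)"
      using uniformizerD(3)[OF p g(1,2)] by blast
    ultimately have "zariski_near S P (\<lambda>Q. g Q = 0)"
      by (rule zariski_near_mono2) simp
    then show False
      using g(3) by blast
  qed
  ultimately show "n = 1"
    by fastforce
qed

text \<open>Zariski open sets are open for the classical topology: a form that is nonzero at the
  limit is nonzero at some \<open>Q n\<close>. Convergence is stated for coordinates, since the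
  points themselves carry no topology.\<close>

lemma not_zariski_near_of_tendsto:
  assumes "\<And>i. (\<lambda>n. v n i) \<longlonglongrightarrow> coords P i"
    and "\<And>n. Q n \<in> S" and "\<And>n. coords (Q n) = v n" and "\<And>n. \<not> R (Q n)"
  shows "\<not> zariski_near S P R"
proof
  assume "zariski_near S P R"
  then obtain d H where H: "form d H" "H (coords P) \<noteq> 0" "\<forall>Q\<in>S. H (coords Q) \<noteq> 0 \<longrightarrow> R Q"
    unfolding zariski_near_def by blast
  have "(\<lambda>n. H (v n)) \<longlonglongrightarrow> H (coords P)"
    by (rule form_tendsto[OF H(1) assms(1)])
  then have "\<forall>\<^sub>F n in sequentially. H (v n) \<noteq> 0"
    using H(2) by (rule tendsto_imp_eventually_ne)
  then obtain n where "H (v n) \<noteq> 0"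
    using eventually_happens' sequentially_bot by blast
  then show False
    using H(3) assms(2,3,4) by metis
qed

lemma tendsto_add_inverse_Suc: "(\<lambda>n. (z :: complex) + 1 / of_nat (Suc n)) \<longlonglongrightarrow> z"
  using tendsto_add[OF tendsto_const[of z] LIMSEQ_Suc[OF lim_1_over_n]] by simp

section \<open>The projective line\<close>

lemma coords_proj_line [simp]:
  "coords (Fin z) 0 = z" "coords (Fin z) (Suc 0) = 1" "coords Infty 0 = 1" "coords Infty (Suc 0) = 0"
  "2 \<le> k \<Longrightarrow> coords (p :: proj_line) k = 0"
  by (auto simp: coords_proj_line_def split: proj_line.split)

lemma uniformizer_proj_line: "uniformizer UNIV (Fin a) (\<lambda>Q. coords Q 0 / coords Q 1 - a)"
proof (rule uniformizerI[where j = 1])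
  fix i :: nat
  show "\<exists>h. regular_at UNIV (Fin a) h \<and> zariski_near UNIV (Fin a)
      (\<lambda>Q. coords Q i / coords Q 1 - coords (Fin a) i / coords (Fin a) 1 =
        h Q * (coords Q 0 / coords Q 1 - a))"
  proof (cases "i = 0")
    case True
    then show ?thesis
      by (intro exI[of _ "\<lambda>_. 1"]) (simp add: regular_at_const zariski_near_always)
  next
    case False
    then have "i = 1 \<or> 2 \<le> i" by auto
    then show ?thesis
      by (intro exI[of _ "\<lambda>_. 0"] conjI regular_at_const zariski_near_mono[OF zariski_near_coord[of _ 1]])
        auto
  qed
qed (auto intro!: regular_intros)

text \<open>The index is computed at finite points only; \<open>Infty\<close> is sent to itself, and
  a critical value there is allowed.\<close>

lemma dynamical_belyi_map_id: "dynamical_belyi_map (\<lambda>Q. Q)"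
proof -
  have "ramification_index UNIV UNIV (\<lambda>Q. Q) (Fin a) = 1" for a
  proof (rule ramification_index_unramified[OF morphism_id UNIV_I uniformizer_proj_line unramified_at_id])
    show "\<not> zariski_near UNIV (Fin a) (\<lambda>Q. coords Q 0 / coords Q 1 - a = 0)"
    proof (rule not_zariski_near_of_tendsto)
      let ?Q = "\<lambda>n. Fin (a + 1 / of_nat (Suc n))"
      show "(\<lambda>n. coords (?Q n) i) \<longlonglongrightarrow> coords (Fin a) i" for i
        using tendsto_add_inverse_Suc[of a]
        by (cases "i = 0"; cases "i = 1") (auto simp del: of_nat_Suc)
      show "\<not> coords (?Q n) 0 / coords (?Q n) 1 - a = 0" for n
        by (simp del: of_nat_Suc)
    qed auto
  qed (use uniformizerD(1,2)[OF uniformizer_proj_line] in auto)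
  then have "p \<notin> critical_points UNIV UNIV (\<lambda>Q. Q)" if "p \<noteq> Infty" for p
    using that by (cases p) (auto simp: critical_points_def)
  then have "critical_values UNIV UNIV (\<lambda>Q. Q) \<subseteq> zero_one_infty"
    by (auto simp: critical_values_def zero_one_infty_def)
  moreover have "\<not> (\<lambda>Q. Q :: proj_line) constant_on UNIV"
    unfolding constant_on_def by (metis UNIV_I proj_line.distinct(1))
  ultimately show ?thesis
    unfolding dynamical_belyi_map_def belyi_map_def by (auto intro: morphism_id)
qed

section \<open>The curve \<open>y\<^sup>2 = x\<^sup>3 - x\<close> and its endomorphism of degree two\<close>

definition curve :: weierstrass where
  "curve = \<lparr>wa1 = 0, wa2 = 0, wa3 = 0, wa4 = -1, wa6 = 0\<rparr>"

abbreviation "E \<equiv> ec_points curve"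

lemma curve_sel [simp]: "wa1 curve = 0" "wa2 curve = 0" "wa3 curve = 0" "wa4 curve = -1" "wa6 curve = 0"
  by (simp_all add: curve_def)

lemma Affine_in_E [simp]: "Affine x y \<in> E \<longleftrightarrow> y ^ 2 = x ^ 3 - x"
  by (auto simp: ec_points_def weierstrass_eq_def)

lemma Origin_in_E [simp]: "Origin \<in> E"
  by (simp add: ec_points_def)

lemma elliptic_curve_curve: "elliptic_curve curve"
  unfolding elliptic_curve_def
proof (intro notI, elim exE conjE)
  fix x y
  assume "weierstrass_eq curve x y" "2 * y + wa1 curve * x + wa3 curve = 0"
    "wa1 curve * y = 3 * x ^ 2 + 2 * wa2 curve * x + wa4 curve"
  then have 3: "3 * x ^ 2 = 1" and "x ^ 3 - x = 0"
    by (auto simp: weierstrass_eq_def)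
  moreover have "x ^ 3 - x = x * (x ^ 2 - 1)"
    by (simp add: right_diff_distrib power2_eq_square power3_eq_cube)
  ultimately have "x = 0 \<or> x ^ 2 = 1" by simp
  then show False using 3 by auto
qed

lemma coords_ec_point [simp]:
  "coords (Affine x y) 0 = x" "coords (Affine x y) (Suc 0) = y" "coords (Affine x y) 2 = 1"
  "coords Origin 0 = 0" "coords Origin (Suc 0) = 1" "coords Origin 2 = 0"
  "3 \<le> k \<Longrightarrow> coords (P :: ec_point) k = 0"
  by (auto simp: coords_ec_point_def split: ec_point.split)

text \<open>Every complex number is the abscissa of a point, by \<open>csqrt\<close>. Infinitude
  makes the degree of \<open>psi\<close> well defined and excludes constancy of the Belyi
  maps.\<close>

lemma infinite_E: "infinite E"
proof
  assume fin: "finite E"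
  have "x \<in> (\<lambda>P. coords P 0) ` E" for x
    by (rule image_eqI[of _ _ "Affine x (csqrt (x ^ 3 - x))"]) simp_all
  then have "(\<lambda>P. coords P 0) ` E = UNIV"
    by blast
  then have "finite (UNIV :: complex set)"
    using finite_imageI[OF fin] by metis
  then show False
    by (simp add: infinite_UNIV_char_0)
qed

text \<open>The scaling \<open>(X, Y) \<mapsto> (alpha^2 X, alpha^3 Y)\<close> carries
  \<open>Y^2 = X^3 + 4 X\<close> to \<open>y^2 = x^3 - x\<close> exactly when
  \<open>4 * alpha^4 = -1\<close>, for nonzero \<open>alpha\<close>.\<close>

definition alpha :: complex where
  "alpha = (1 + \<i>) / 2"

lemma alpha: "4 * alpha ^ 4 = -1" "alpha \<noteq> 0"
proof -
  have "alpha ^ 2 = \<i> / 2"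
    unfolding alpha_def by (simp add: power2_eq_square field_simps)
  then have "alpha ^ 4 = (\<i> / 2) ^ 2"
    by (metis mult_2 numeral_Bit0 power_mult mult.commute one_add_one power2_eq_square power_add)
  then show "4 * alpha ^ 4 = -1" by (simp add: power_divide)
  then show "alpha \<noteq> 0" by auto
qed

text \<open>
  Complex multiplication by \<open>1 - \<i>\<close>, up to a unit: the 2-isogeny with kernel \<open>{O, (0, 0)}\<close> has image
  \<open>Y\<^sup>2 = X\<^sup>3 + 4 X\<close>, which the scaling by \<open>alpha\<close> brings back to the original curve.
\<close>

fun psi :: "ec_point \<Rightarrow> ec_point" where
  "psi Origin = Origin"
| "psi (Affine x y) = (if x = 0 then Origin
     else Affine (alpha ^ 2 * (y / x) ^ 2) (alpha ^ 3 * (y / x) * (x + 1 / x)))"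

fun phi :: "ec_point \<Rightarrow> proj_line" where
  "phi Origin = Infty"
| "phi (Affine x y) = Fin (x ^ 2)"

text \<open>From \<open>w^2 = x - u\<close> and \<open>x u = 1\<close> follows
  \<open>(x + u)^2 = w^4 + 4\<close>, so \<open>(w^2, w (x + u))\<close> lies on
  \<open>Y^2 = X^3 + 4 X\<close>.\<close>

lemma psi_in_E: "P \<in> E \<Longrightarrow> psi P \<in> E"
proof (cases P)
  case (Affine x y)
  assume "P \<in> E"
  then have y: "y ^ 2 = x ^ 3 - x" using Affine by simp
  show ?thesis
  proof (cases "x = 0")
    case False
    define w where "w = y / x"
    define u where "u = 1 / x"
    have xu: "x * u = 1" "y = w * x" using False by (simp_all add: w_def u_def)
    then have w: "w ^ 2 = x - u" using y False by algebra
    have "(x + u) ^ 2 = (w ^ 2) ^ 2 + 4"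
      using w xu(1) by algebra
    moreover have "4 * alpha ^ 6 = - (alpha ^ 2)"
      using alpha(1) by algebra
    ultimately have "(alpha ^ 3 * w * (x + u)) ^ 2 = (alpha ^ 2 * w ^ 2) ^ 3 - alpha ^ 2 * w ^ 2"
      by algebra
    then show ?thesis using Affine False by (simp add: w_def u_def)
  qed (use Affine in simp)
qed simp

lemma ec_pointE:
  assumes "P \<in> E"
  obtains "P = Origin" | x y where "P = Affine x y" "y ^ 2 = x ^ 3 - x"
  using assms by (cases P) auto

text \<open>Clearing denominators in the affine formula gives the triple of the last case, which
  vanishes at both points of the kernel. The other two triples are multiples of it by rational
  functions, rewritten with the equation of the curve so that they survive at one kernel point
  each.\<close>

lemma morphism_psi: "morphism E E psi"
proof (rule morphismI)
  fix P assume P: "P \<in> E"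
  then show "psi P \<in> E" by (rule psi_in_E)
  show "coords (psi P) k = 0" if "3 \<le> k" for k using that by simp
  consider "P = Origin" | "P = Affine 0 0" | x y where "P = Affine x y" "x \<noteq> 0"
  proof -
    from P show thesis
      by (cases rule: ec_pointE) (use that in \<open>fastforce+\<close>)
  qed
  then show "\<exists>d A B C. given_by E psi P d A B C"
  proof cases
    case 1
    \<comment> \<open>The generic triple times \<open>v0 / v2\<close>, where the curve gives
      \<open>v0^3 / v2 = v1^2 + v0 v2\<close>.\<close>
    have "given_by E psi P 3
      (\<lambda>v. alpha ^ 2 * (v 0 * v 1 ^ 2))
      (\<lambda>v. alpha ^ 3 * (v 1 * (2 * (v 0 * v 2) + v 1 ^ 2)))
      (\<lambda>v. v 0 ^ 3)"
      unfolding given_by_def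
    proof (intro conjI ballI)
      show "form 3 (\<lambda>v. alpha ^ 2 * (v 0 * v 1 ^ 2))"
        "form 3 (\<lambda>v. alpha ^ 3 * (v 1 * (2 * (v 0 * v 2) + v 1 ^ 2)))"
        "form 3 (\<lambda>v. v 0 ^ 3)"
        by (rule form_intros refl | simp)+
      show "alpha ^ 2 * (coords P 0 * coords P 1 ^ 2) \<noteq> 0 \<or>
        alpha ^ 3 * (coords P 1 * (2 * (coords P 0 * coords P 2) + coords P 1 ^ 2)) \<noteq> 0 \<or> coords P 0 ^ 3 \<noteq> 0"
        using 1 alpha by simp
      fix Q assume "Q \<in> E"
      then show "\<exists>c. alpha ^ 2 * (coords Q 0 * coords Q 1 ^ 2) = c * coords (psi Q) 0 \<and>
          alpha ^ 3 * (coords Q 1 * (2 * (coords Q 0 * coords Q 2) + coords Q 1 ^ 2)) = c * coords (psi Q) 1 \<and>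
          coords Q 0 ^ 3 = c * coords (psi Q) 2"
      proof (cases rule: ec_pointE)
        case 1
        then show ?thesis by (intro exI[of _ "alpha ^ 3"]) simp
      next
        case (2 x y)
        show ?thesis
        proof (cases "x = 0")
          case True
          then show ?thesis using 2 by simp
        next
          case False
          have "y * (2 * x + y ^ 2) = x ^ 3 * (y / x * (x + 1 / x))"
            unfolding 2(2) using False by (simp add: field_simps power3_eq_cube)
          moreover have "x * y ^ 2 = x ^ 3 * (y / x) ^ 2"
            using False by (simp add: field_simps power3_eq_cube power2_eq_square)
          ultimately show ?thesis
            using 2(1) False by (intro exI[of _ "x ^ 3"]) simp
        qed
      qed
    qed
    then show ?thesis by blast
  next
    case 2
    \<comment> \<open>The generic triple times \<open>v1 v2 / v0\<close>, where the curve gives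
      \<open>v1^2 v2 / v0 = v0^2 - v2^2\<close>.\<close>
    have "given_by E psi P 4
      (\<lambda>v. alpha ^ 2 * (v 1 * v 2 * (v 0 ^ 2 - v 2 ^ 2)))
      (\<lambda>v. alpha ^ 3 * ((v 0 ^ 2 + v 2 ^ 2) * (v 0 ^ 2 - v 2 ^ 2)))
      (\<lambda>v. v 0 * v 1 * v 2 ^ 2)"
      unfolding given_by_def
    proof (intro conjI ballI)
      show "form 4 (\<lambda>v. alpha ^ 2 * (v 1 * v 2 * (v 0 ^ 2 - v 2 ^ 2)))"
        "form 4 (\<lambda>v. alpha ^ 3 * ((v 0 ^ 2 + v 2 ^ 2) * (v 0 ^ 2 - v 2 ^ 2)))"
        "form 4 (\<lambda>v. v 0 * v 1 * v 2 ^ 2)"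
        by (rule form_intros refl | simp)+
      show "alpha ^ 2 * (coords P 1 * coords P 2 * (coords P 0 ^ 2 - coords P 2 ^ 2)) \<noteq> 0 \<or>
        alpha ^ 3 * ((coords P 0 ^ 2 + coords P 2 ^ 2) * (coords P 0 ^ 2 - coords P 2 ^ 2)) \<noteq> 0 \<or>
        coords P 0 * coords P 1 * coords P 2 ^ 2 \<noteq> 0"
        using 2 alpha by simp
      fix Q assume "Q \<in> E"
      then show "\<exists>c. alpha ^ 2 * (coords Q 1 * coords Q 2 * (coords Q 0 ^ 2 - coords Q 2 ^ 2)) = c * coords (psi Q) 0 \<and>
          alpha ^ 3 * ((coords Q 0 ^ 2 + coords Q 2 ^ 2) * (coords Q 0 ^ 2 - coords Q 2 ^ 2)) = c * coords (psi Q) 1 \<and>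
          coords Q 0 * coords Q 1 * coords Q 2 ^ 2 = c * coords (psi Q) 2"
      proof (cases rule: ec_pointE)
        case 1
        then show ?thesis by (intro exI[of _ 0]) simp
      next
        case (2 x y)
        show ?thesis
        proof (cases "x = 0")
          case True
          then show ?thesis using 2 by (intro exI[of _ "- (alpha ^ 3)"]) simp
        next
          case False
          have "y * (x ^ 2 - 1) = x * y * (y / x) ^ 2"
            "(x ^ 2 + 1) * (x ^ 2 - 1) = x * y * (y / x * (x + 1 / x))"
            using False 2(2) by (simp_all add: field_simps power2_eq_square) algebra+
          then show ?thesis
            using 2(1) False by (intro exI[of _ "x * y"]) simp
        qed
      qed
    qed
    then show ?thesis by blast
  next
    case (3 x y)
    have "given_by E psi P 3
      (\<lambda>v. alpha ^ 2 * (v 1 ^ 2 * v 2))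
      (\<lambda>v. alpha ^ 3 * (v 1 * (v 0 ^ 2 + v 2 ^ 2)))
      (\<lambda>v. v 0 ^ 2 * v 2)"
      unfolding given_by_def
    proof (intro conjI ballI)
      show "form 3 (\<lambda>v. alpha ^ 2 * (v 1 ^ 2 * v 2))"
        "form 3 (\<lambda>v. alpha ^ 3 * (v 1 * (v 0 ^ 2 + v 2 ^ 2)))"
        "form 3 (\<lambda>v. v 0 ^ 2 * v 2)"
        by (rule form_intros refl | simp)+
      show "alpha ^ 2 * (coords P 1 ^ 2 * coords P 2) \<noteq> 0 \<or>
        alpha ^ 3 * (coords P 1 * (coords P 0 ^ 2 + coords P 2 ^ 2)) \<noteq> 0 \<or>
        coords P 0 ^ 2 * coords P 2 \<noteq> 0"
        using 3 by simp
      fix Q assume "Q \<in> E"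
      then show "\<exists>c. alpha ^ 2 * (coords Q 1 ^ 2 * coords Q 2) = c * coords (psi Q) 0 \<and>
          alpha ^ 3 * (coords Q 1 * (coords Q 0 ^ 2 + coords Q 2 ^ 2)) = c * coords (psi Q) 1 \<and>
          coords Q 0 ^ 2 * coords Q 2 = c * coords (psi Q) 2"
      proof (cases rule: ec_pointE)
        case 1
        then show ?thesis by (intro exI[of _ 0]) simp
      next
        case (2 x y)
        then show ?thesis
          by (intro exI[of _ "x ^ 2"]) (auto simp: field_simps power2_eq_square)
      qed
    qed
    then show ?thesis by blast
  qed
qed

lemma morphism_phi: "morphism E UNIV phi"
proof (rule morphismI)
  fix P assume P: "P \<in> E"
  show "coords (phi P) k = 0" if "3 \<le> k" for k using that by simp
  from P show "\<exists>d A B C. given_by E phi P d A B C"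
  proof (cases rule: ec_pointE)
    case 1
    \<comment> \<open>The pair \<open>(v0^2, v2^2)\<close> vanishes at \<open>Origin\<close>; it is
      multiplied by \<open>v0^4 / v2^2\<close>, again with
      \<open>v0^3 / v2 = v1^2 + v0 v2\<close>.\<close>
    have "given_by E phi P 4
      (\<lambda>v. (v 1 ^ 2 + v 0 * v 2) ^ 2)
      (\<lambda>v. v 0 ^ 4)
      (\<lambda>v. 0)"
      unfolding given_by_def
    proof (intro conjI ballI)
      show "form 4 (\<lambda>v. (v 1 ^ 2 + v 0 * v 2) ^ 2)" "form 4 (\<lambda>v. v 0 ^ 4)"
        by (rule form_intros refl | simp)+
      show "form 4 (\<lambda>v. 0)" by (rule form_zero)
      show "(coords P 1 ^ 2 + coords P 0 * coords P 2) ^ 2 \<noteq> 0 \<or> coords P 0 ^ 4 \<noteq> 0 \<or> (0 :: complex) \<noteq> 0"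
        using 1 by simp
      fix Q assume "Q \<in> E"
      then show "\<exists>c. (coords Q 1 ^ 2 + coords Q 0 * coords Q 2) ^ 2 = c * coords (phi Q) 0 \<and>
          coords Q 0 ^ 4 = c * coords (phi Q) 1 \<and> 0 = c * coords (phi Q) 2"
      proof (cases rule: ec_pointE)
        case 1
        then show ?thesis by (intro exI[of _ 1]) simp
      next
        case (2 x y)
        then show ?thesis by (intro exI[of _ "x ^ 4"]) (simp add: power_eq_if)
      qed
    qed
    then show ?thesis by blast
  next
    case (2 x y)
    have "given_by E phi P 2
      (\<lambda>v. v 0 ^ 2)
      (\<lambda>v. v 2 ^ 2)
      (\<lambda>v. 0)"
      unfolding given_by_def
    proof (intro conjI ballI)
      show "form 2 (\<lambda>v. v 0 ^ 2)" "form 2 (\<lambda>v. v 2 ^ 2)"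
        by (rule form_intros refl | simp)+
      show "form 2 (\<lambda>v. 0)" by (rule form_zero)
      show "coords P 0 ^ 2 \<noteq> 0 \<or> coords P 2 ^ 2 \<noteq> 0 \<or> (0 :: complex) \<noteq> 0"
        using 2 by simp
      fix Q assume "Q \<in> E"
      then show "\<exists>c. coords Q 0 ^ 2 = c * coords (phi Q) 0 \<and>
          coords Q 2 ^ 2 = c * coords (phi Q) 1 \<and> 0 = c * coords (phi Q) 2"
      proof (cases rule: ec_pointE)
        case 1
        then show ?thesis by (intro exI[of _ 0]) simp
      next
        case (2 x y)
        then show ?thesis by (intro exI[of _ 1]) simp
      qed
    qed
    then show ?thesis by blast
  qed
qed simp

section \<open>The group law\<close>

text \<open>The \<open>x\<^sub>i\<close> are, with multiplicity, the abscissae of the intersection with the line \<open>y = l x + m\<close>.\<close>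

definition chord :: "complex \<Rightarrow> complex \<Rightarrow> complex \<Rightarrow> complex \<Rightarrow> complex \<Rightarrow> bool" where
  "chord l m x1 x2 x3 \<longleftrightarrow> x1 + x2 + x3 = l ^ 2 \<and> x1 * x2 + x1 * x3 + x2 * x3 = - 1 - 2 * l * m \<and>
     x1 * x2 * x3 = m ^ 2"

lemma chord_on_curve:
  assumes "chord l m x1 x2 x3"
  shows "(l * x1 + m) ^ 2 = x1 ^ 3 - x1" "(l * x2 + m) ^ 2 = x2 ^ 3 - x2" "(l * x3 + m) ^ 2 = x3 ^ 3 - x3"
  using assms unfolding chord_def by algebra+

text \<open>Replaces the case distinction for the slope in \<open>ec_add\<close> by the relations of
  \<open>chord\<close>, which are polynomial and symmetric in the three abscissae.\<close>

lemma ec_add_chord: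
  assumes c: "chord l m x1 x2 x3" and n: "\<not> (x1 = x2 \<and> l * x1 + m + (l * x2 + m) = 0)"
  shows "ec_add curve (Affine x1 (l * x1 + m)) (Affine x2 (l * x2 + m)) = Affine x3 (- (l * x3 + m))"
proof -
  have x3: "l ^ 2 - x1 - x2 = x3"
    using c unfolding chord_def by algebra
  show ?thesis
  proof (cases "x1 = x2")
    case True
    \<comment> \<open>The derivative of \<open>x^3 - x - (l x + m)^2\<close> vanishes at the double
      root \<open>x1\<close>.\<close>
    have "3 * x1 ^ 2 - 1 = l * (2 * (l * x1 + m))"
      using c True unfolding chord_def by algebra
    moreover have "2 * (l * x1 + m) \<noteq> 0"
      using n True by auto
    ultimately have "(3 * x1 ^ 2 - 1) / (2 * (l * x1 + m)) = l"
      by simp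
    moreover have "l ^ 2 - 3 * x2 = x3 - x2"
      using x3 True by (simp add: algebra_simps)
    ultimately show ?thesis
      using True n x3 by (simp add: Let_def algebra_simps)
  next
    case False
    have "l * x2 + m - (l * x1 + m) = l * (x2 - x1)"
      by algebra
    then have "(l * x2 + m - (l * x1 + m)) / (x2 - x1) = l"
      using False by simp
    moreover have "l ^ 2 - x2 - 2 * x1 = x3 - x1"
      using x3 by (simp add: algebra_simps)
    ultimately show ?thesis
      using False x3 by (simp add: Let_def algebra_simps)
  qed
qed

lemma chordE:
  assumes 1: "y1 ^ 2 = x1 ^ 3 - x1" and 2: "y2 ^ 2 = x2 ^ 3 - x2" and n: "\<not> (x1 = x2 \<and> y1 + y2 = 0)"
  obtains l m x3 where "chord l m x1 x2 x3" and "y1 = l * x1 + m" and "y2 = l * x2 + m"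
proof -
  define l where "l = (if x1 = x2 then (3 * x1 ^ 2 - 1) / (2 * y1) else (y2 - y1) / (x2 - x1))"
  define m where "m = y1 - l * x1"
  define x3 where "x3 = l ^ 2 - x1 - x2"
  \<comment> \<open>\<open>r * x + s\<close> is the difference between
    \<open>x^3 - x - (l x + m)^2\<close> and \<open>(x - x1) (x - x2) (x - x3)\<close>; the choice
    of \<open>x3\<close> cancels the quadratic term. It vanishes at \<open>x1\<close> and
    \<open>x2\<close>, and in the tangent case its derivative vanishes too, so it is zero.\<close>
  define r where "r = - 1 - 2 * l * m - (x1 * x2 + x1 * x3 + x2 * x3)"
  define s where "s = x1 * x2 * x3 - m ^ 2"
  have y1: "y1 = l * x1 + m"
    by (simp add: m_def)
  have eq: "y1 = y2 \<and> y1 \<noteq> 0" if "x1 = x2"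
  proof -
    have "y1 ^ 2 = y2 ^ 2" using 1 2 that by simp
    then show ?thesis using n that by (auto simp: power2_eq_iff)
  qed
  have y2: "y2 = l * x2 + m"
  proof (cases "x1 = x2")
    case True
    then show ?thesis using eq y1 by simp
  next
    case False
    then have "l * (x2 - x1) = y2 - y1"
      by (simp add: l_def)
    then show ?thesis using y1 by algebra
  qed
  have r1: "r * x1 + s = 0"
    using 1 y1 unfolding r_def s_def x3_def by algebra
  have r2: "r * x2 + s = 0"
    using 2 y2 unfolding r_def s_def x3_def by algebra
  have r: "r = 0"
  proof (cases "x1 = x2")
    case True
    then have "l * (2 * y1) = 3 * x1 ^ 2 - 1"
      using conjunct2[OF eq[OF True]] by (simp add: l_def)
    then show ?thesis using True y1 unfolding r_def x3_def by algebra
  next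
    case False
    have "r * (x1 - x2) = 0" using r1 r2 by algebra
    then show ?thesis using False by simp
  qed
  then have "s = 0"
    using r1 by simp
  then have "chord l m x1 x2 x3"
    using r unfolding chord_def r_def s_def x3_def by (auto simp: algebra_simps)
  then show thesis
    using that y1 y2 by blast
qed

lemma ec_add_in_E:
  assumes "P \<in> E" "Q \<in> E"
  shows "ec_add curve P Q \<in> E"
proof (cases P)
  case Origin
  then show ?thesis using assms by simp
next
  case P: (Affine x1 y1)
  show ?thesis
  proof (cases Q)
    case Origin
    then show ?thesis using assms P by simp
  next
    case Q: (Affine x2 y2)
    show ?thesis
    proof (cases "x1 = x2 \<and> y1 + y2 = 0")
      case True
      then show ?thesis using P Q by simp
    next
      case n: False
      obtain l m x3 where c: "chord l m x1 x2 x3" and y: "y1 = l * x1 + m" "y2 = l * x2 + m"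
        using chordE[OF _ _ n] assms P Q by auto
      have "ec_add curve P Q = Affine x3 (- (l * x3 + m))"
        using ec_add_chord[OF c] n unfolding P Q y by blast
      then show ?thesis
        using chord_on_curve(3)[OF c] by (simp only: Affine_in_E power2_minus)
    qed
  qed
qed

section \<open>Inverses in the group of the curve\<close>

fun ec_neg :: "ec_point \<Rightarrow> ec_point" where
  "ec_neg Origin = Origin"
| "ec_neg (Affine x y) = Affine x (- y)"

lemma ec_neg_in_E: "P \<in> E \<Longrightarrow> ec_neg P \<in> E"
  by (cases P) auto

lemma ec_add_eq_Origin_iff: "ec_add curve P Q = Origin \<longleftrightarrow> Q = ec_neg P"
  by (cases P; cases Q) (auto simp: Let_def add_eq_0_iff)

text \<open>\<open>m_inv\<close> is a definite description; its uniqueness is read off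
  \<open>ec_add_eq_Origin_iff\<close>.\<close>

lemma inv_ec_group:
  assumes "P \<in> E"
  shows "inv\<^bsub>ec_group curve\<^esub> P = ec_neg P"
proof -
  have "P = ec_neg (ec_neg P)" by (cases P) auto
  then have *: "ec_add curve (ec_neg P) P = Origin"
    using ec_add_eq_Origin_iff by blast
  show ?thesis
    unfolding m_inv_def
  proof (rule the_equality)
    have "ec_add curve P (ec_neg P) = Origin"
      using ec_add_eq_Origin_iff by blast
    then show "ec_neg P \<in> carrier (ec_group curve) \<and> P \<otimes>\<^bsub>ec_group curve\<^esub> ec_neg P = \<one>\<^bsub>ec_group curve\<^esub> \<and>
        ec_neg P \<otimes>\<^bsub>ec_group curve\<^esub> P = \<one>\<^bsub>ec_group curve\<^esub>"
      using * ec_neg_in_E[OF assms] by (simp add: ec_group_def)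
  next
    fix Q
    assume "Q \<in> carrier (ec_group curve) \<and> P \<otimes>\<^bsub>ec_group curve\<^esub> Q = \<one>\<^bsub>ec_group curve\<^esub> \<and>
        Q \<otimes>\<^bsub>ec_group curve\<^esub> P = \<one>\<^bsub>ec_group curve\<^esub>"
    then have "ec_add curve P Q = Origin"
      by (simp add: ec_group_def)
    then show "Q = ec_neg P"
      by (rule iffD1[OF ec_add_eq_Origin_iff])
  qed
qed

text \<open>For \<open>m \<noteq> 0\<close> the line misses \<open>(0, 0)\<close>, so no
  \<open>x_i\<close> is 0. The ratios \<open>w_i = l + m / x_i\<close>, which are
  \<open>y_i / x_i\<close>, have elementary symmetric functions \<open>l - 1/m\<close>,
  \<open>-2 l/m\<close> and \<open>m - l^2/m\<close>, found from those of \<open>1 / x_i\<close>.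
  The images have abscissae \<open>alpha^2 w_i^2\<close>, whose symmetric functions are expressed
  through these three.\<close>

lemma chord_psi:
  assumes c: "chord l m x1 x2 x3" and m: "m \<noteq> 0"
  shows "chord (alpha * (l + 1 / m)) (alpha ^ 3 * (m - l ^ 2 / m))
    (alpha ^ 2 * (l + m / x1) ^ 2) (alpha ^ 2 * (l + m / x2) ^ 2) (alpha ^ 2 * (l + m / x3) ^ 2)"
proof -
  define p where "p = 1 / m"
  define u1 where "u1 = 1 / x1"
  define u2 where "u2 = 1 / x2"
  define u3 where "u3 = 1 / x3"
  define w1 where "w1 = l + m * u1"
  define w2 where "w2 = l + m * u2"
  define w3 where "w3 = l + m * u3"
  note e = c[unfolded chord_def]
  have x: "x1 \<noteq> 0" "x2 \<noteq> 0" "x3 \<noteq> 0"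
    using e m by auto
  have p: "m * p = 1" using m by (simp add: p_def)
  have pm: "p ^ 2 * m ^ 2 = 1" using p by algebra
  have xu: "x1 * u1 = 1" "x2 * u2 = 1" "x3 * u3 = 1"
    using x by (simp_all add: u1_def u2_def u3_def)
  have u3': "u1 * u2 * u3 = p ^ 2"
  proof -
    have "(u1 * u2 * u3) * m ^ 2 = (x1 * u1) * (x2 * u2) * (x3 * u3)"
      using e by algebra
    also have "\<dots> = p ^ 2 * m ^ 2" using xu pm by simp
    finally show ?thesis using m by simp
  qed
  have u1': "u1 + u2 + u3 = p ^ 2 * (- 1 - 2 * l * m)"
  proof -
    have "u1 + u2 + u3 = (u1 * u2 * u3) * (x1 * x2 + x1 * x3 + x2 * x3)"
      using xu by algebra
    then show ?thesis using u3' e by simp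
  qed
  have u2': "u1 * u2 + u1 * u3 + u2 * u3 = p ^ 2 * l ^ 2"
  proof -
    have "u1 * u2 + u1 * u3 + u2 * u3 = (u1 * u2 * u3) * (x1 + x2 + x3)"
      using xu by algebra
    then show ?thesis using u3' e by simp
  qed
  have s1: "w1 + w2 + w3 = l - p"
  proof -
    have "w1 + w2 + w3 = 3 * l + m * (u1 + u2 + u3)"
      unfolding w1_def w2_def w3_def by algebra
    then show ?thesis unfolding u1' using p by algebra
  qed
  have s2: "w1 * w2 + w1 * w3 + w2 * w3 = - 2 * l * p"
  proof -
    have "w1 * w2 + w1 * w3 + w2 * w3 =
        3 * l ^ 2 + 2 * l * m * (u1 + u2 + u3) + m ^ 2 * (u1 * u2 + u1 * u3 + u2 * u3)"
      unfolding w1_def w2_def w3_def by algebra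
    then show ?thesis unfolding u1' u2' using p by algebra
  qed
  have s3: "w1 * w2 * w3 = m - l ^ 2 * p"
  proof -
    have "w1 * w2 * w3 = l ^ 3 + l ^ 2 * m * (u1 + u2 + u3) +
        l * m ^ 2 * (u1 * u2 + u1 * u3 + u2 * u3) + m ^ 3 * (u1 * u2 * u3)"
      unfolding w1_def w2_def w3_def by algebra
    then show ?thesis unfolding u1' u2' u3' using p by algebra
  qed
  let ?a = alpha
  have "?a ^ 2 * w1 ^ 2 + ?a ^ 2 * w2 ^ 2 + ?a ^ 2 * w3 ^ 2 = (?a * (l + p)) ^ 2"
  proof -
    have "?a ^ 2 * w1 ^ 2 + ?a ^ 2 * w2 ^ 2 + ?a ^ 2 * w3 ^ 2 =
        ?a ^ 2 * ((w1 + w2 + w3) ^ 2 - 2 * (w1 * w2 + w1 * w3 + w2 * w3))"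
      by algebra
    then show ?thesis unfolding s1 s2 by algebra
  qed
  moreover have "(?a ^ 2 * w1 ^ 2) * (?a ^ 2 * w2 ^ 2) + (?a ^ 2 * w1 ^ 2) * (?a ^ 2 * w3 ^ 2) +
      (?a ^ 2 * w2 ^ 2) * (?a ^ 2 * w3 ^ 2) =
      - 1 - 2 * (?a * (l + p)) * (?a ^ 3 * (m - l ^ 2 * p))"
  proof -
    have "(?a ^ 2 * w1 ^ 2) * (?a ^ 2 * w2 ^ 2) + (?a ^ 2 * w1 ^ 2) * (?a ^ 2 * w3 ^ 2) +
      (?a ^ 2 * w2 ^ 2) * (?a ^ 2 * w3 ^ 2) =
      ?a ^ 4 * ((w1 * w2 + w1 * w3 + w2 * w3) ^ 2 - 2 * (w1 + w2 + w3) * (w1 * w2 * w3))"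
      by algebra
    \<comment> \<open>The left side exceeds \<open>- 2 alpha^4 (l + p) (m - l^2 p)\<close> by
      \<open>4 alpha^4 m p\<close>, which is \<open>-1\<close> by the choice of
      \<open>alpha\<close>.\<close>
    then show ?thesis unfolding s1 s2 s3 using p alpha(1) by algebra
  qed
  moreover have "(?a ^ 2 * w1 ^ 2) * (?a ^ 2 * w2 ^ 2) * (?a ^ 2 * w3 ^ 2) = (?a ^ 3 * (m - l ^ 2 * p)) ^ 2"
    unfolding s3[symmetric] by algebra
  ultimately show ?thesis
    unfolding chord_def w1_def w2_def w3_def u1_def u2_def u3_def p_def by simp
qed

text \<open>Here \<open>x + u = w^2 + 2 u\<close> with \<open>u = (w - l) / m\<close>, and
  \<open>w\<close> is a root of the cubic with coefficients from \<open>chord_psi\<close>.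
  Eliminating \<open>w^3\<close> leaves \<open>w (x + u)\<close> affine in \<open>w^2\<close>, which
  is the origin of the slope and intercept of the image line.\<close>

lemma psi_on_chord:
  assumes "(l * x + m) ^ 2 = x ^ 3 - x" and x: "x \<noteq> 0" and m: "m \<noteq> 0"
  shows "psi (Affine x (l * x + m)) = (let X = alpha ^ 2 * (l + m / x) ^ 2
    in Affine X (alpha * (l + 1 / m) * X + alpha ^ 3 * (m - l ^ 2 / m)))"
proof -
  define u where "u = 1 / x"
  define p where "p = 1 / m"
  define w where "w = l + m * u"
  have xu: "x * u = 1" and mp: "m * p = 1"
    using x m by (simp_all add: u_def p_def)
  have wx: "w * x = l * x + m"
    unfolding w_def using xu by algebra
  have w: "w ^ 2 = x - u"
    using assms(1) wx xu by algebra
  have "w * (x + u) = (l + p) * w ^ 2 + (m - l ^ 2 * p)"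
  proof -
    have 1: "m * u = w - l" by (simp add: w_def)
    have "m * (w * (x + u)) = m * ((l + p) * w ^ 2 + (m - l ^ 2 * p))"
      using mp w wx 1 by algebra
    then show ?thesis using m by simp
  qed
  then have "alpha ^ 3 * w * (x + u) = alpha * (l + p) * (alpha ^ 2 * w ^ 2) + alpha ^ 3 * (m - l ^ 2 * p)"
    by algebra
  moreover have "(l * x + m) / x = w"
    using wx x by (simp add: field_simps)
  ultimately show ?thesis
    using x by (simp add: Let_def u_def p_def w_def)
qed

lemma psi_ec_neg: "psi (ec_neg P) = ec_neg (psi P)"
  by (cases P) auto

text \<open>A double root with ordinate 0 would be a common zero of \<open>x^3 - x\<close> and its
  derivative. This supplies the side condition of \<open>ec_add_chord\<close> for image points,
  whose abscissae may coincide.\<close>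

lemma chord_not_opposite:
  assumes c: "chord l m x1 x2 x3"
  shows "x1 = x2 \<Longrightarrow> l * x1 + m + (l * x2 + m) \<noteq> 0"
proof
  assume h: "x1 = x2" "l * x1 + m + (l * x2 + m) = 0"
  then have "2 * (l * x1 + m) = 0" by simp
  then have 0: "l * x1 + m = 0" by (simp only: mult_eq_0_iff) simp
  have "3 * x1 ^ 2 - 1 = l * (2 * (l * x1 + m))"
    using c h(1) unfolding chord_def by algebra
  then have 1: "3 * x1 ^ 2 = 1" unfolding 0 by simp
  have "x1 ^ 3 - x1 = 0"
    using chord_on_curve(1)[OF c] unfolding 0 by simp
  moreover have "x1 ^ 3 - x1 = x1 * (x1 ^ 2 - 1)"
    by (simp add: right_diff_distrib power2_eq_square power3_eq_cube)
  ultimately have "x1 = 0 \<or> x1 ^ 2 = 1" by simp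
  then show False using 1 by auto
qed

text \<open>Two kinds of lines escape \<open>chord_psi\<close>: vertical ones, settled by
  compatibility with negation, and lines through \<open>(0, 0)\<close>, on which the affine formula
  for \<open>psi\<close> breaks down.\<close>

lemma psi_ec_add:
  assumes "P \<in> E" and "Q \<in> E"
  shows "psi (ec_add curve P Q) = ec_add curve (psi P) (psi Q)"
proof (cases P)
  case Origin
  then show ?thesis by simp
next
  case P: (Affine x1 y1)
  show ?thesis
  proof (cases Q)
    case Origin
    then show ?thesis using P by (cases "psi P") simp_all
  next
    case Q: (Affine x2 y2)
    have E1: "y1 ^ 2 = x1 ^ 3 - x1" and E2: "y2 ^ 2 = x2 ^ 3 - x2"
      using assms P Q by simp_all
    show ?thesis
    proof (cases "x1 = x2 \<and> y1 + y2 = 0")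
      case True
      then have Q: "Q = ec_neg P"
        using P Q by (simp add: add_eq_0_iff)
      then have "ec_add curve P Q = Origin" "ec_add curve (psi P) (psi Q) = Origin"
        by (simp_all only: psi_ec_neg ec_add_eq_Origin_iff)
      then show ?thesis by simp
    next
      case n: False
      obtain l m x3 where c: "chord l m x1 x2 x3" and y: "y1 = l * x1 + m" "y2 = l * x2 + m"
        using chordE[OF E1 E2 n] by blast
      have R: "ec_add curve P Q = Affine x3 (- (l * x3 + m))"
        using ec_add_chord[OF c] n unfolding P Q y by blast
      note e = c[unfolded chord_def]
      show ?thesis
      proof (cases "m = 0")
        case False
        then have x: "x1 \<noteq> 0" "x2 \<noteq> 0" "x3 \<noteq> 0"
          using e by auto
        note c' = chord_psi[OF c False]
        note p = psi_on_chord[OF chord_on_curve(1)[OF c] x(1) False]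
          psi_on_chord[OF chord_on_curve(2)[OF c] x(2) False]
          psi_on_chord[OF chord_on_curve(3)[OF c] x(3) False]
        have "psi (ec_add curve P Q) = ec_neg (psi (Affine x3 (l * x3 + m)))"
          unfolding R psi_ec_neg[symmetric] by simp
        also have "\<dots> = ec_add curve (psi P) (psi Q)"
          unfolding P Q y p Let_def ec_neg.simps
          using ec_add_chord[OF c'] chord_not_opposite[OF c'] by presburger
        finally show ?thesis .
      next
        case m: True
        have y: "y1 = l * x1" "y2 = l * x2" using y m by simp_all
        \<comment> \<open>One intersection point is \<open>(0, 0)\<close> and the other two
          abscissae have product \<open>-1\<close>. So the claim becomes invariance of
          \<open>psi\<close> under translation by \<open>(0, 0)\<close>, or, if the third point is
          \<open>(0, 0)\<close>, that the two images are opposite.\<close>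
        consider "x1 = 0" | "x1 \<noteq> 0" "x2 = 0" | "x1 \<noteq> 0" "x2 \<noteq> 0" "x3 = 0"
          using e m by auto
        then show ?thesis
        proof cases
          case 1
          then have x: "x2 * x3 = -1" using e m by simp
          then have x0: "x2 \<noteq> 0" "x3 \<noteq> 0" by auto
          then have x3: "x3 = - (1 / x2)" using x by (simp add: field_simps)
          show ?thesis
            using 1 x0 unfolding R unfolding P Q y m by (simp add: x3 field_simps)
        next
          case 2
          then have x: "x1 * x3 = -1" using e m by simp
          then have x0: "x1 \<noteq> 0" "x3 \<noteq> 0" by auto
          then have x3: "x3 = - (1 / x1)" using x by (simp add: field_simps)
          show ?thesis
            using 2 x0 unfolding R unfolding P Q y m by (simp add: x3 field_simps)
        next
          case 3
          then have x: "x1 * x2 = -1" using e m by simp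
          then have x2: "x2 = - (1 / x1)" using 3 by (simp add: field_simps)
          have "psi Q = ec_neg (psi P)"
            using 3(1) unfolding P Q y by (simp add: x2 field_simps)
          then have "ec_add curve (psi P) (psi Q) = Origin"
            by (simp only: ec_add_eq_Origin_iff)
          then show ?thesis
            using 3(3) m unfolding R by simp
        qed
      qed
    qed
  qed
qed

lemma isogeny_psi: "isogeny curve curve psi"
  unfolding isogeny_def hom_def ec_group_def using morphism_psi psi_in_E psi_ec_add by auto

section \<open>The fibres of the endomorphism\<close>

text \<open>When \<open>X \<noteq> 0\<close>, the abscissa \<open>X\<close> fixes
  \<open>w = y / x\<close> up to sign, and then \<open>x - 1/x = w^2\<close> and
  \<open>x + 1/x = Y / (alpha^3 w)\<close> fix \<open>x\<close>. The fibres over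
  \<open>Origin\<close> and \<open>(0, 0)\<close> are listed by hand.\<close>

lemma card_psi_fibre:
  assumes "Q \<in> E"
  shows "card {P\<in>E. psi P = Q} = 2"
  using assms
proof (cases rule: ec_pointE)
  case 1
  have "{P\<in>E. psi P = Q} = {Origin, Affine 0 0}"
    unfolding 1 by (auto elim!: ec_pointE split: if_splits)
  then show ?thesis by simp
next
  case (2 X Y)
  show ?thesis
  proof (cases "X = 0")
    case True
    then have Y: "Y = 0" using 2 by simp
    have "P \<in> {Affine 1 0, Affine (-1) 0}" if P: "P \<in> E" "psi P = Q" for P
      using P(1)
    proof (cases rule: ec_pointE)
      case 1
      then show ?thesis using P 2 by simp
    next
      case (2 x y)
      then have "x \<noteq> 0" "y = 0"
        using P \<open>Q = Affine X Y\<close> True alpha(2) by (auto split: if_splits)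
      moreover have "x ^ 3 - x = x * (x ^ 2 - 1)"
        by (simp add: right_diff_distrib power2_eq_square power3_eq_cube)
      ultimately have "x ^ 2 = 1" using 2 by simp
      then show ?thesis using 2 \<open>y = 0\<close> by (auto simp: power2_eq_1_iff)
    qed
    then have "{P\<in>E. psi P = Q} = {Affine 1 0, Affine (-1) 0}"
      using 2(1) True Y by auto
    then show ?thesis by simp
  next
    case X: False
    \<comment> \<open>Half the sum of the prescribed values of \<open>x - 1/x\<close> and
      \<open>x + 1/x\<close>.\<close>
    define pt where "pt w = (let x = (w ^ 2 + Y / (alpha ^ 3 * w)) / 2 in Affine x (w * x))" for w
    have pt: "\<exists>x. x \<noteq> 0 \<and> pt w = Affine x (w * x) \<and> pt w \<in> E \<and> psi (pt w) = Q"
      if w: "alpha ^ 2 * w ^ 2 = X" for w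
    proof -
      have w0: "w \<noteq> 0" using w X by auto
      define v where "v = Y / (alpha ^ 3 * w)"
      have Y: "Y = alpha ^ 3 * w * v" using w0 alpha(2) by (simp add: v_def)
      have "alpha ^ 6 * w ^ 2 * v ^ 2 = alpha ^ 6 * w ^ 2 * (w ^ 4 + 4)"
        using 2(2) Y w alpha(1) by algebra
      \<comment> \<open>This is the compatibility of the two prescribed values: it forces
        \<open>x * u = 1\<close> for their half sum \<open>x\<close> and half difference
        \<open>u\<close>.\<close>
      then have v: "v ^ 2 = w ^ 4 + 4" using w0 alpha(2) by simp
      define x where "x = (w ^ 2 + v) / 2"
      define u where "u = (v - w ^ 2) / 2"
      have xu: "x * u = 1"
        using v by (simp add: x_def u_def field_simps power2_eq_square power4_eq_xxxx)
      then have x0: "x \<noteq> 0" by auto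
      then have u: "u = 1 / x" using xu by (simp add: eq_divide_eq mult.commute)
      have xpu: "x + u = v" and xmu: "x - u = w ^ 2" by (simp_all add: x_def u_def field_simps)
      have "(w * x) ^ 2 = x ^ 3 - x" using xmu xu by algebra
      moreover have "psi (Affine x (w * x)) = Q"
        using x0 w xpu unfolding 2(1) Y by (simp add: u)
      moreover have "pt w = Affine x (w * x)"
        by (simp add: pt_def x_def v_def Let_def)
      ultimately show ?thesis using x0 by auto
    qed
    obtain w where w: "alpha ^ 2 * w ^ 2 = X"
    proof
      show "alpha ^ 2 * csqrt (X / alpha ^ 2) ^ 2 = X" using alpha(2) by simp
    qed
    then have w0: "w \<noteq> 0" using X by auto
    have "P \<in> {pt w, pt (- w)}" if P: "P \<in> E" "psi P = Q" for P
      using P(1)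
    proof (cases rule: ec_pointE)
      case 1
      then show ?thesis using P 2 by simp
    next
      case P': (2 x y)
      define z where "z = y / x"
      have x0: "x \<noteq> 0" and XY: "X = alpha ^ 2 * z ^ 2" "Y = alpha ^ 3 * z * (x + 1 / x)"
        using P P'(1) 2(1) by (auto simp: z_def split: if_splits)
      have z0: "z \<noteq> 0" using X XY by auto
      have y: "y = z * x" using x0 by (simp add: z_def)
      have "x * (x * z ^ 2) = x * (x ^ 2 - 1)"
        using P'(2) unfolding y by algebra
      then have "x * z ^ 2 = x ^ 2 - 1"
        using x0 by simp
      then have "z ^ 2 = x - 1 / x"
        using x0 by (simp add: field_simps power2_eq_square)
      moreover have "Y / (alpha ^ 3 * z) = x + 1 / x"
        using XY(2) alpha(2) z0 by simp
      ultimately have "pt z = P"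
        using P'(1) y by (simp add: pt_def)
      moreover have "z ^ 2 = w ^ 2"
        using XY(1) w alpha(2) by simp
      then have "z = w \<or> z = - w"
        by (simp add: power2_eq_iff)
      ultimately show ?thesis by auto
    qed
    then have "{P\<in>E. psi P = Q} = {pt w, pt (- w)}"
      using pt[of w] pt[of "- w"] w by auto
    moreover have "pt w \<noteq> pt (- w)"
      using pt[of w] pt[of "- w"] w w0 by auto
    ultimately show ?thesis by simp
  qed
qed

lemma finite_psi_fibre: "Q \<in> E \<Longrightarrow> finite {P\<in>E. psi P = Q}"
  by (rule card_ge_0_finite) (simp add: card_psi_fibre)

lemma map_degree_psi: "map_degree E E psi = 2"
proof -
  show ?thesis
    unfolding map_degree_def
  proof (rule the_equality)
    have "{Q\<in>E. \<not> (finite {P\<in>E. psi P = Q} \<and> card {P\<in>E. psi P = Q} = 2)} = {}"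
      using finite_psi_fibre card_psi_fibre by blast
    then show "finite {Q\<in>E. \<not> (finite {P\<in>E. psi P = Q} \<and> card {P\<in>E. psi P = Q} = 2)}"
      by (simp only: finite.emptyI)
  next
    fix n
    assume *: "finite {Q\<in>E. \<not> (finite {P\<in>E. psi P = Q} \<and> card {P\<in>E. psi P = Q} = n)}"
    show "n = 2"
    proof (rule ccontr)
      assume "n \<noteq> 2"
      \<comment> \<open>For a wrong \<open>n\<close> every point is exceptional, and
        \<open>E\<close> is infinite.\<close>
      then have "{Q\<in>E. \<not> (finite {P\<in>E. psi P = Q} \<and> card {P\<in>E. psi P = Q} = n)} = E"
        using card_psi_fibre by blast
      then show False using * infinite_E by argo
    qed
  qed
qed

lemma card_psi_preimage:
  assumes "finite A" and "A \<subseteq> E"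
  shows "finite {P\<in>E. psi P \<in> A}" and "card {P\<in>E. psi P \<in> A} = 2 * card A"
proof -
  have eq: "{P\<in>E. psi P \<in> A} = (\<Union>Q\<in>A. {P\<in>E. psi P = Q})"
    by auto
  show "finite {P\<in>E. psi P \<in> A}"
    unfolding eq using assms finite_psi_fibre by blast
  have "card (\<Union>Q\<in>A. {P\<in>E. psi P = Q}) = (\<Sum>Q\<in>A. card {P\<in>E. psi P = Q})"
    using assms finite_psi_fibre by (intro card_UN_disjoint) blast+
  also have "\<dots> = (\<Sum>Q\<in>A. 2)"
    using assms card_psi_fibre by (intro sum.cong) auto
  finally show "card {P\<in>E. psi P \<in> A} = 2 * card A"
    unfolding eq by simp
qed

section \<open>Uniformizers on the curve\<close>

text \<open>\<open>cx\<close>, \<open>cy\<close> are the affine coordinates; \<open>ox\<close>,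
  \<open>oz\<close> are \<open>x / y\<close> and \<open>1 / y\<close>, the coordinates of the chart
  around \<open>Origin\<close>. Outside their chart they take the value 0 of division by
  zero.\<close>

abbreviation "cx Q \<equiv> coords (Q :: ec_point) 0 / coords Q 2"
abbreviation "cy Q \<equiv> coords (Q :: ec_point) (Suc 0) / coords Q 2"
abbreviation "ox Q \<equiv> coords (Q :: ec_point) 0 / coords Q (Suc 0)"
abbreviation "oz Q \<equiv> coords (Q :: ec_point) 2 / coords Q (Suc 0)"

lemma regular_affine_coords: "regular_at E (Affine x y) cx" "regular_at E (Affine x y) cy"
  by (rule regular_at_coord; simp)+

lemma regular_origin_coords: "regular_at E Origin ox" "regular_at E Origin oz"
  by (rule regular_at_coord; simp)+

lemma near_affineI:
  assumes "\<And>x y. y ^ 2 = x ^ 3 - x \<Longrightarrow> R (Affine x y)"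
  shows "zariski_near E (Affine x0 y0) R"
proof (rule zariski_near_mono[OF zariski_near_coord[of _ 2]])
  fix Q assume "Q \<in> E" "coords Q 2 \<noteq> 0"
  then show "R Q" using assms by (cases Q) auto
qed simp

lemma near_affine_nonzeroI:
  assumes "regular_at E (Affine x0 y0) g" and "Affine x0 y0 \<in> E" and "g (Affine x0 y0) \<noteq> 0"
    and "\<And>x y. y ^ 2 = x ^ 3 - x \<Longrightarrow> g (Affine x y) \<noteq> 0 \<Longrightarrow> R (Affine x y)"
  shows "zariski_near E (Affine x0 y0) R"
  by (rule zariski_near_mono2[OF regular_at_nonzero_near[OF assms(2,1,3)]
        near_affineI[of "\<lambda>Q. g Q \<noteq> 0 \<longrightarrow> R Q"]]) (use assms(4) in auto)

lemma near_origin_nonzeroI: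
  assumes "regular_at E Origin g" and "g Origin \<noteq> 0" and "R Origin"
    and "\<And>x y. y ^ 2 = x ^ 3 - x \<Longrightarrow> y \<noteq> 0 \<Longrightarrow> g (Affine x y) \<noteq> 0 \<Longrightarrow> R (Affine x y)"
  shows "zariski_near E Origin R"
proof (rule zariski_near_mono2[OF regular_at_nonzero_near[OF Origin_in_E assms(1,2)]
      zariski_near_coord[of _ "Suc 0"]])
  fix Q assume "Q \<in> E" "g Q \<noteq> 0" "coords Q (Suc 0) \<noteq> 0"
  then show "R Q" using assms(3,4) by (cases Q) auto
qed simp

lemma nat_cases_3: "(i :: nat) = 0 \<or> i = Suc 0 \<or> i = 2 \<or> 3 \<le> i"
  by auto

text \<open>Subtracting the equations at two points gives
  \<open>(y - y0) (y + y0) = (x^2 + x x0 + x0^2 - 1) (x - x0)\<close>, and \<open>y + y0\<close> is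
  a unit when \<open>y0 \<noteq> 0\<close>.\<close>

lemma uniformizer_x:
  assumes P: "Affine x0 y0 \<in> E" and y0: "y0 \<noteq> 0"
  shows "uniformizer E (Affine x0 y0) (\<lambda>Q. cx Q - x0)"
proof (rule uniformizerI[where j = 2])
  fix i :: nat
  let ?G = "\<lambda>h. regular_at E (Affine x0 y0) h \<and> zariski_near E (Affine x0 y0)
      (\<lambda>Q. coords Q i / coords Q 2 - coords (Affine x0 y0) i / coords (Affine x0 y0) 2 = h Q * (cx Q - x0))"
  note reg = regular_affine_coords[of x0 y0]
  have y: "regular_at E (Affine x0 y0) (\<lambda>Q. cy Q + y0)"
    by (intro regular_at_add regular_at_const reg)
  have "?G (\<lambda>_. 1)" if "i = 0"
    using that by (auto intro!: regular_at_const near_affineI)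
  moreover have "?G (\<lambda>Q. (cx Q ^ 2 + cx Q * x0 + x0 ^ 2 - 1) / (cy Q + y0))" if "i = Suc 0"
  proof
    show "regular_at E (Affine x0 y0) (\<lambda>Q. (cx Q ^ 2 + cx Q * x0 + x0 ^ 2 - 1) / (cy Q + y0))"
      by (intro regular_at_divide[OF P] y regular_at_diff regular_at_add regular_at_mult
          regular_at_power regular_at_const reg) (use y0 in simp)
    show "zariski_near E (Affine x0 y0) (\<lambda>Q. coords Q i / coords Q 2 -
        coords (Affine x0 y0) i / coords (Affine x0 y0) 2 =
        (cx Q ^ 2 + cx Q * x0 + x0 ^ 2 - 1) / (cy Q + y0) * (cx Q - x0))"
    proof (rule near_affine_nonzeroI[OF y P])
      fix x y assume h: "y ^ 2 = x ^ 3 - x" "cy (Affine x y) + y0 \<noteq> 0"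
      have "(y - y0) * (y + y0) = (x ^ 2 + x * x0 + x0 ^ 2 - 1) * (x - x0)"
        using h(1) P unfolding Affine_in_E by algebra
      then have "y - y0 = (x ^ 2 + x * x0 + x0 ^ 2 - 1) * (x - x0) / (y + y0)"
        using h(2) by (simp add: eq_divide_eq)
      then show "coords (Affine x y) i / coords (Affine x y) 2 -
          coords (Affine x0 y0) i / coords (Affine x0 y0) 2 =
          (cx (Affine x y) ^ 2 + cx (Affine x y) * x0 + x0 ^ 2 - 1) / (cy (Affine x y) + y0) *
          (cx (Affine x y) - x0)"
        using that by simp
    qed (use y0 in simp)
  qed
  moreover have "?G (\<lambda>_. 0)" if "i = 2 \<or> 3 \<le> i"
    using that by (auto intro!: regular_at_const near_affineI)
  ultimately show "\<exists>h. ?G h"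
    using nat_cases_3[of i] by blast
qed (use P in \<open>auto intro!: regular_at_diff regular_at_const regular_affine_coords\<close>)

text \<open>The same factorisation with \<open>y0 = 0\<close>, solved for \<open>x - x0\<close>: now
  the quadratic factor is the unit.\<close>

lemma uniformizer_y:
  assumes P: "Affine x0 0 \<in> E"
  shows "uniformizer E (Affine x0 0) cy"
proof (rule uniformizerI[where j = 2])
  fix i :: nat
  let ?G = "\<lambda>h. regular_at E (Affine x0 0) h \<and> zariski_near E (Affine x0 0)
      (\<lambda>Q. coords Q i / coords Q 2 - coords (Affine x0 0) i / coords (Affine x0 0) 2 = h Q * cy Q)"
  let ?g = "\<lambda>Q. cx Q ^ 2 + cx Q * x0 + x0 ^ 2 - 1"
  note reg = regular_affine_coords[of x0 0]
  have g: "regular_at E (Affine x0 0) ?g"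
    by (intro regular_at_diff regular_at_add regular_at_mult regular_at_power regular_at_const reg)
  have x0: "x0 ^ 3 - x0 = 0" using P by simp
  moreover have "x0 ^ 3 - x0 = x0 * (x0 ^ 2 - 1)"
    by (simp add: right_diff_distrib power2_eq_square power3_eq_cube)
  ultimately have "x0 = 0 \<or> x0 ^ 2 = 1" by simp
  \<comment> \<open>The value is \<open>3 * x0^2 - 1\<close>, that is \<open>-1\<close> or
    \<open>2\<close>.\<close>
  then have g0: "?g (Affine x0 0) \<noteq> 0"
    by (auto simp: power2_eq_square)
  have "?G (\<lambda>Q. cy Q / ?g Q)" if "i = 0"
  proof
    show "regular_at E (Affine x0 0) (\<lambda>Q. cy Q / ?g Q)"
      by (rule regular_at_divide[OF P reg(2) g g0])
    show "zariski_near E (Affine x0 0) (\<lambda>Q. coords Q i / coords Q 2 -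
        coords (Affine x0 0) i / coords (Affine x0 0) 2 = cy Q / ?g Q * cy Q)"
    proof (rule near_affine_nonzeroI[OF g P g0])
      fix x y assume h: "y ^ 2 = x ^ 3 - x" "?g (Affine x y) \<noteq> 0"
      have "(x - x0) * (x ^ 2 + x * x0 + x0 ^ 2 - 1) = y * y"
        using h(1) x0 by algebra
      then have "x - x0 = y * y / (x ^ 2 + x * x0 + x0 ^ 2 - 1)"
        using h(2) by (simp add: eq_divide_eq)
      then show "coords (Affine x y) i / coords (Affine x y) 2 -
          coords (Affine x0 0) i / coords (Affine x0 0) 2 =
          cy (Affine x y) / ?g (Affine x y) * cy (Affine x y)"
        using that by simp
    qed
  qed
  moreover have "?G (\<lambda>_. 1)" if "i = Suc 0"
    using that by (auto intro!: regular_at_const near_affineI)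
  moreover have "?G (\<lambda>_. 0)" if "i = 2 \<or> 3 \<le> i"
    using that by (auto intro!: regular_at_const near_affineI)
  ultimately show "\<exists>h. ?G h"
    using nat_cases_3[of i] by blast
qed (use P in \<open>auto intro!: regular_affine_coords\<close>)

text \<open>With \<open>t = x / y\<close> and \<open>s = 1 / y\<close> the equation near \<open>O\<close> reads \<open>s (1 + t s) = t\<^sup>3\<close>.\<close>

lemma regular_origin_unit: "regular_at E Origin (\<lambda>Q. 1 + ox Q * oz Q)"
  by (intro regular_at_add regular_at_mult regular_at_const regular_origin_coords)

lemma uniformizer_origin: "uniformizer E Origin ox"
proof (rule uniformizerI[where j = "Suc 0"])
  fix i :: nat
  let ?G = "\<lambda>h. regular_at E Origin h \<and> zariski_near E Origin
      (\<lambda>Q. coords Q i / coords Q (Suc 0) - coords Origin i / coords Origin (Suc 0) = h Q * ox Q)"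
  let ?g = "\<lambda>Q. 1 + ox Q * oz Q"
  note reg = regular_origin_coords
  have near: "zariski_near E Origin R" if "R Origin" "\<And>x y. y \<noteq> 0 \<Longrightarrow> R (Affine x y)" for R
    by (rule near_origin_nonzeroI[OF regular_at_const[of _ _ 1]]) (use that in auto)
  have "?G (\<lambda>_. 1)" if "i = 0"
    using that by (auto intro!: regular_at_const near)
  moreover have "?G (\<lambda>_. 0)" if "i = Suc 0"
    using that by (auto intro!: regular_at_const near)
  moreover have "?G (\<lambda>Q. ox Q ^ 2 / ?g Q)" if "i = 2"
  proof
    show "regular_at E Origin (\<lambda>Q. ox Q ^ 2 / ?g Q)"
      by (intro regular_at_divide[OF Origin_in_E] regular_at_power reg regular_origin_unit) simp
    show "zariski_near E Origin (\<lambda>Q. coords Q i / coords Q (Suc 0) -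
        coords Origin i / coords Origin (Suc 0) = ox Q ^ 2 / ?g Q * ox Q)"
    proof (rule near_origin_nonzeroI[OF regular_origin_unit])
      fix x y assume h: "y ^ 2 = x ^ 3 - x" "y \<noteq> 0" "?g (Affine x y) \<noteq> 0"
      have "1 / y * (1 + x / y * (1 / y)) = (y ^ 2 + x) / y ^ 3"
        using h(2) by (simp add: field_simps power2_eq_square power3_eq_cube)
      also have "\<dots> = (x / y) ^ 2 * (x / y)"
        using h(1) by (simp add: power2_eq_square power3_eq_cube)
      finally have eq: "1 / y * (1 + x / y * (1 / y)) = (x / y) ^ 2 * (x / y)" .
      have "1 + x / y * (1 / y) \<noteq> 0"
        using h(3) by simp
      then have "1 / y = (x / y) ^ 2 * (x / y) / (1 + x / y * (1 / y))"
        using eq by (rule iffD2[OF nonzero_eq_divide_eq])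
      also have "\<dots> = (x / y) ^ 2 / (1 + x / y * (1 / y)) * (x / y)"
        by (rule times_divide_eq_left[symmetric])
      finally show "coords (Affine x y) i / coords (Affine x y) (Suc 0) - coords Origin i / coords Origin (Suc 0) =
          ox (Affine x y) ^ 2 / ?g (Affine x y) * ox (Affine x y)"
        unfolding that coords_ec_point by (simp only: div_0 diff_zero)
    qed (use that in simp_all)
  qed
  moreover have "?G (\<lambda>_. 0)" if "3 \<le> i"
    using that by (auto intro!: regular_at_const near)
  ultimately show "\<exists>h. ?G h"
    using nat_cases_3[of i] by blast
qed (auto intro!: regular_origin_coords)

text \<open>\<open>csqrt\<close> is not continuous, so at each abscissa near \<open>x0\<close> the
  root closer to \<open>y0\<close> is taken. Then
  \<open>norm (y - y0)^2 \<le> norm (y^2 - y0^2)\<close>, which tends to 0, also when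
  \<open>y0 = 0\<close>.\<close>

lemma affine_not_isolated:
  assumes P: "Affine x0 y0 \<in> E"
  shows "\<not> zariski_near E (Affine x0 y0) (\<lambda>Q. cx Q - x0 = 0)"
proof -
  define x where "x n = x0 + 1 / of_nat (Suc n)" for n
  have x: "x \<longlonglongrightarrow> x0"
    unfolding x_def by (rule tendsto_add_inverse_Suc)
  have "\<exists>y. y ^ 2 = x n ^ 3 - x n \<and> norm (y - y0) \<le> norm (y + y0)" for n
  proof -
    let ?y = "csqrt (x n ^ 3 - x n)"
    show ?thesis
    proof (cases "norm (?y - y0) \<le> norm (?y + y0)")
      case True
      then show ?thesis by (intro exI[of _ ?y]) simp
    next
      case False
      moreover have "norm (- ?y - y0) = norm (?y + y0)" "norm (- ?y + y0) = norm (?y - y0)"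
        by (metis minus_add_distrib norm_minus_cancel uminus_add_conv_diff add.commute)
          (metis norm_minus_commute uminus_add_conv_diff)
      ultimately show ?thesis by (intro exI[of _ "- ?y"]) simp
    qed
  qed
  then obtain y where y: "\<And>n. y n ^ 2 = x n ^ 3 - x n" "\<And>n. norm (y n - y0) \<le> norm (y n + y0)"
    by metis
  have bound: "norm (y n - y0) ^ 2 \<le> norm (y n ^ 2 - y0 ^ 2)" for n
  proof -
    have "norm (y n - y0) ^ 2 \<le> norm (y n - y0) * norm (y n + y0)"
      unfolding power2_eq_square by (rule mult_left_mono[OF y(2)]) simp
    also have "\<dots> = norm (y n ^ 2 - y0 ^ 2)"
      by (simp add: norm_mult[symmetric] power2_eq_square algebra_simps)
    finally show ?thesis .
  qed
  have "(\<lambda>n. y n ^ 2 - y0 ^ 2) \<longlonglongrightarrow> (x0 ^ 3 - x0) - y0 ^ 2"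
    unfolding y(1) by (intro tendsto_intros x)
  then have lim: "(\<lambda>n. norm (y n ^ 2 - y0 ^ 2)) \<longlonglongrightarrow> 0"
    using P by (simp add: tendsto_norm_zero)
  have "(\<lambda>n. norm (y n - y0) ^ 2) \<longlonglongrightarrow> 0"
    by (rule tendsto_sandwich[OF _ _ tendsto_const lim]) (simp_all add: bound)
  then have "(\<lambda>n. sqrt (norm (y n - y0) ^ 2)) \<longlonglongrightarrow> sqrt 0"
    by (rule tendsto_real_sqrt)
  then have "(\<lambda>n. y n - y0) \<longlonglongrightarrow> 0"
    by (simp add: tendsto_norm_zero_iff)
  then have ylim: "y \<longlonglongrightarrow> y0"
    by (rule LIM_zero_cancel)
  show ?thesis
  proof (rule not_zariski_near_of_tendsto)
    show "(\<lambda>n. coords (Affine (x n) (y n)) i) \<longlonglongrightarrow> coords (Affine x0 y0) i" for i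
      using nat_cases_3[of i] x ylim by auto
    show "Affine (x n) (y n) \<in> E" for n
      using y(1) by simp
    show "\<not> cx (Affine (x n) (y n)) - x0 = 0" for n
      by (simp add: x_def del: of_nat_Suc)
  qed simp
qed

section \<open>The endomorphism is unramified\<close>

text \<open>The function \<open>x / y\<close> pulls back to \<open>y / (alpha (x^2 + 1))\<close>.
  Since \<open>y = x (x^2 - 1) / y\<close>, this is \<open>x / y\<close> times
  \<open>(1 - 1/x^2) / (1 + 1/x^2) / alpha\<close>, a unit at \<open>Origin\<close>.\<close>

lemma unramified_psi_origin: "unramified_at E E psi Origin"
proof (rule unramified_atI[OF morphism_psi Origin_in_E])
  show "uniformizer E (psi Origin) ox"
    using uniformizer_origin by simp
  \<comment> \<open>\<open>s\<close> extends \<open>1 / x\<close> to \<open>Origin\<close> as a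
    regular function with value 0.\<close>
  define s where "s Q = ox Q ^ 2 / (1 + ox Q * oz Q)" for Q
  have s: "regular_at E Origin s"
    unfolding s_def
    by (intro regular_at_divide[OF Origin_in_E] regular_at_power regular_origin_coords regular_origin_unit) simp
  have s0: "s Origin = 0" by (simp add: s_def)
  have s_affine: "s (Affine x y) = 1 / x" if "y ^ 2 = x ^ 3 - x" "y \<noteq> 0" for x y
  proof -
    have "1 + x / y * (1 / y) = x ^ 3 / y ^ 2"
      using that by (simp add: field_simps power2_eq_square)
    then have "s (Affine x y) = (x / y) ^ 2 / (x ^ 3 / y ^ 2)"
      by (simp add: s_def)
    also have "\<dots> = 1 / x"
      using that by (cases "x = 0") (simp_all add: field_simps power2_eq_square power3_eq_cube)
    finally show ?thesis .
  qed
  let ?d = "\<lambda>Q. 1 + s Q ^ 2"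
  have d: "regular_at E Origin ?d"
    by (intro regular_at_add regular_at_power regular_at_const s)
  show "uniformizer E Origin (\<lambda>Q. ox (psi Q))"
  proof (rule uniformizer_unit_multiple[OF uniformizer_origin Origin_in_E])
    show "regular_at E Origin (\<lambda>Q. 1 / alpha * ((1 - s Q ^ 2) / ?d Q))"
      by (intro regular_at_mult regular_at_divide[OF Origin_in_E] d regular_at_diff regular_at_power
          regular_at_const s) (simp add: s0)
    show "1 / alpha * ((1 - s Origin ^ 2) / ?d Origin) \<noteq> 0"
      using alpha(2) by (simp add: s0)
    show "zariski_near E Origin (\<lambda>Q. ox (psi Q) = 1 / alpha * ((1 - s Q ^ 2) / ?d Q) * ox Q)"
    proof (rule near_origin_nonzeroI[OF d])
      fix x y assume h: "y ^ 2 = x ^ 3 - x" "y \<noteq> 0" "?d (Affine x y) \<noteq> 0"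
      then have x: "x \<noteq> 0" by auto
      have n: "x ^ 2 + 1 \<noteq> 0"
        using h(3) x unfolding s_affine[OF h(1,2)] by (simp add: field_simps power_divide)
      have "ox (psi (Affine x y)) = alpha ^ 2 * (y / x) ^ 2 / (alpha ^ 3 * (y / x) * (x + 1 / x))"
        using x by simp
      also have "\<dots> = y / (alpha * (x ^ 2 + 1))"
        using x h(2) n alpha(2) by (simp add: divide_simps) (simp add: power2_eq_square power3_eq_cube algebra_simps)
      also have "\<dots> = 1 / alpha * ((1 - (1 / x) ^ 2) / (1 + (1 / x) ^ 2)) * (x / y)"
      proof -
        have "(1 - (1 / x) ^ 2) / (1 + (1 / x) ^ 2) = (x ^ 2 - 1) / (x ^ 2 + 1)"
          using x n by (simp add: divide_simps)
        moreover have "y * y = (x ^ 2 - 1) * x"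
          using h(1) by algebra
        then have "y = (x ^ 2 - 1) * x / y"
          using h(2) by (simp only: nonzero_eq_divide_eq[OF h(2)])
        then have "y / (alpha * (x ^ 2 + 1)) = (x ^ 2 - 1) * x / y / (alpha * (x ^ 2 + 1))"
          by (rule arg_cong)
        ultimately show ?thesis
          by simp
      qed
      finally show "ox (psi (Affine x y)) =
          1 / alpha * ((1 - s (Affine x y) ^ 2) / ?d (Affine x y)) * ox (Affine x y)"
        unfolding s_affine[OF h(1,2)] by simp
    qed (simp_all add: s0)
  qed
qed

text \<open>The pullback \<open>y / (alpha (x^2 + 1))\<close> of \<open>x / y\<close> is directly a
  unit times the uniformizer \<open>y\<close> here.\<close>

lemma unramified_psi_kernel: "unramified_at E E psi (Affine 0 0)"
proof (rule unramified_atI[OF morphism_psi])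
  show P: "Affine 0 0 \<in> E" by simp
  show "uniformizer E (psi (Affine 0 0)) ox"
    using uniformizer_origin by simp
  note reg = regular_affine_coords[of 0 0]
  let ?d = "\<lambda>Q. alpha * (1 + cx Q ^ 2)"
  have d: "regular_at E (Affine 0 0) ?d"
    by (intro regular_at_mult regular_at_add regular_at_power regular_at_const reg)
  have d0: "?d (Affine 0 0) \<noteq> 0"
    using alpha(2) by simp
  show "uniformizer E (Affine 0 0) (\<lambda>Q. ox (psi Q))"
  proof (rule uniformizer_unit_multiple[OF uniformizer_y[OF P] P])
    show "regular_at E (Affine 0 0) (\<lambda>Q. 1 / ?d Q)"
      by (rule regular_at_divide[OF P regular_at_const d d0])
    show "1 / ?d (Affine 0 0) \<noteq> 0"
      using d0 by simp
    show "zariski_near E (Affine 0 0) (\<lambda>Q. ox (psi Q) = 1 / ?d Q * cy Q)"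
    proof (rule near_affine_nonzeroI[OF d P d0])
      fix x y assume h: "y ^ 2 = x ^ 3 - x" "?d (Affine x y) \<noteq> 0"
      show "ox (psi (Affine x y)) = 1 / ?d (Affine x y) * cy (Affine x y)"
      proof (cases "x = 0 \<or> y = 0")
        \<comment> \<open>Both sides are 0: for \<open>x = 0\<close> the image is
          \<open>Origin\<close>; for \<open>y = 0\<close> and \<open>x \<noteq> 0\<close> it is
          \<open>(0, 0)\<close>, where \<open>ox\<close> is \<open>0 / 0 = 0\<close>.\<close>
        case True
        then show ?thesis using h by auto
      next
        case False
        have n: "1 + x ^ 2 \<noteq> 0" using h(2) by simp
        have "x + 1 / x = (1 + x ^ 2) / x"
          using False by (simp add: field_simps power2_eq_square)
        then have "ox (psi (Affine x y)) = alpha ^ 2 * (y / x) ^ 2 / (alpha ^ 3 * (y / x) * ((1 + x ^ 2) / x))"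
          using False by simp
        also have "\<dots> = 1 / (alpha * (1 + x ^ 2)) * y"
          using False n alpha(2) by (simp add: power2_eq_square power3_eq_cube)
        finally show ?thesis by simp
      qed
    qed
  qed
qed

text \<open>The cases follow the available uniformizers. If \<open>Y0 \<noteq> 0\<close>, use
  \<open>x - X0\<close> at the image and \<open>x - x0\<close> at the source. Otherwise use
  \<open>y\<close> at the image; then either \<open>y0 = 0\<close>, with \<open>y\<close> at the
  source, or \<open>x0^2 = -1\<close>, with \<open>x - x0\<close> at the source. Each pullback is a
  unit times the source uniformizer.\<close>

lemma unramified_psi_affine:
  assumes P: "Affine x0 y0 \<in> E" and x0: "x0 \<noteq> 0"
  shows "unramified_at E E psi (Affine x0 y0)"
proof -
  define X0 where "X0 = alpha ^ 2 * (y0 / x0) ^ 2"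
  define Y0 where "Y0 = alpha ^ 3 * (y0 / x0) * (x0 + 1 / x0)"
  have psiP: "psi (Affine x0 y0) = Affine X0 Y0"
    using x0 by (simp add: X0_def Y0_def)
  have Q: "Affine X0 Y0 \<in> E"
    using psi_in_E[OF P] unfolding psiP .
  note reg = regular_affine_coords[of x0 y0]
  have near: "zariski_near E (Affine x0 y0) R"
    if "\<And>(x :: complex) y. y ^ 2 = x ^ 3 - x \<Longrightarrow> x \<noteq> 0 \<Longrightarrow> R (Affine x y)" for R
    by (rule near_affine_nonzeroI[OF reg(1) P]) (use that x0 in auto)
  have sq: "(y / x) ^ 2 = x - 1 / x" if "y ^ 2 = x ^ 3 - x" "x \<noteq> 0" for x y :: complex
    using that by (simp add: power_divide) (simp add: field_simps power2_eq_square power3_eq_cube)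
  have y0sq: "y0 ^ 2 = x0 * (x0 ^ 2 - 1)"
    using P by (simp add: right_diff_distrib power2_eq_square power3_eq_cube)
  show ?thesis
  proof (cases "Y0 = 0")
    case False
    then have y0: "y0 \<noteq> 0" and n: "x0 + 1 / x0 \<noteq> 0"
      by (auto simp: Y0_def)
    let ?u = "\<lambda>Q. alpha ^ 2 * (1 + 1 / (cx Q * x0))"
    show ?thesis
    proof (rule unramified_atI[OF morphism_psi P])
      show "uniformizer E (psi (Affine x0 y0)) (\<lambda>Q. cx Q - X0)"
        unfolding psiP by (rule uniformizer_x[OF Q False])
      show "uniformizer E (Affine x0 y0) (\<lambda>Q. cx (psi Q) - X0)"
      proof (rule uniformizer_unit_multiple[OF uniformizer_x[OF P y0] P])
        show "regular_at E (Affine x0 y0) ?u"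
          by (intro regular_at_mult regular_at_add regular_at_divide[OF P] regular_at_const reg)
            (use x0 in simp)
        have "1 + 1 / (x0 * x0) = (x0 + 1 / x0) / x0"
          using x0 by (simp add: field_simps)
        then show "?u (Affine x0 y0) \<noteq> 0"
          using alpha(2) n x0 by simp
        show "zariski_near E (Affine x0 y0) (\<lambda>Q. cx (psi Q) - X0 = ?u Q * (cx Q - x0))"
        proof (rule near)
          fix x y :: complex assume h: "y ^ 2 = x ^ 3 - x" "x \<noteq> 0"
          have "cx (psi (Affine x y)) - X0 = alpha ^ 2 * ((x - 1 / x) - (x0 - 1 / x0))"
            using h x0 P by (simp add: X0_def sq right_diff_distrib)
          also have "(x - 1 / x) - (x0 - 1 / x0) = (1 + 1 / (x * x0)) * (x - x0)"
            using h(2) x0 by (simp add: field_simps)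
          finally show "cx (psi (Affine x y)) - X0 = ?u (Affine x y) * (cx (Affine x y) - x0)"
            by simp
        qed
      qed
    qed
  next
    case True
    have t: "uniformizer E (psi (Affine x0 y0)) cy"
      using uniformizer_y[of X0] Q unfolding psiP True by blast
    show ?thesis
    proof (cases "y0 = 0")
      case y0: True
      then have "x0 ^ 2 = 1"
        using y0sq x0 by simp
      then have n: "x0 + 1 / x0 \<noteq> 0"
        using x0 by (auto simp: field_simps power2_eq_square)
      let ?u = "\<lambda>Q. alpha ^ 3 / cx Q * (cx Q + 1 / cx Q)"
      show ?thesis
      proof (rule unramified_atI[OF morphism_psi P t])
        have "uniformizer E (Affine x0 y0) cy"
          using uniformizer_y[of x0] P unfolding y0 by blast
        then show "uniformizer E (Affine x0 y0) (\<lambda>Q. cy (psi Q))"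
        proof (rule uniformizer_unit_multiple[OF _ P])
          show "regular_at E (Affine x0 y0) ?u"
            by (intro regular_at_mult regular_at_add regular_at_divide[OF P] regular_at_const reg)
              (use x0 in simp_all)
          show "?u (Affine x0 y0) \<noteq> 0"
            using alpha(2) n x0 by simp
          show "zariski_near E (Affine x0 y0) (\<lambda>Q. cy (psi Q) = ?u Q * cy Q)"
            by (rule near) simp
        qed
      qed
    next
      case y0: False
      then have "x0 + 1 / x0 = 0"
        using True alpha(2) x0 by (simp add: Y0_def)
      then have n: "x0 ^ 2 = - 1"
        using x0 by (simp add: field_simps power2_eq_square add_eq_0_iff)
      let ?u = "\<lambda>Q. alpha ^ 3 * cy Q * (cx Q + x0) / cx Q ^ 2"
      show ?thesis
      proof (rule unramified_atI[OF morphism_psi P t])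
        show "uniformizer E (Affine x0 y0) (\<lambda>Q. cy (psi Q))"
        proof (rule uniformizer_unit_multiple[OF uniformizer_x[OF P y0] P])
          show "regular_at E (Affine x0 y0) ?u"
            by (intro regular_at_mult regular_at_add regular_at_divide[OF P] regular_at_power
                regular_at_const reg) (use x0 in simp)
          show "?u (Affine x0 y0) \<noteq> 0"
            using alpha(2) y0 x0 by simp
          show "zariski_near E (Affine x0 y0) (\<lambda>Q. cy (psi Q) = ?u Q * (cx Q - x0))"
          proof (rule near)
            fix x y :: complex assume h: "y ^ 2 = x ^ 3 - x" "x \<noteq> 0"
            have "x + 1 / x = (x ^ 2 + 1) / x"
              using h(2) by (simp add: field_simps power2_eq_square)
            also have "x ^ 2 + 1 = (x + x0) * (x - x0)"
              using n by algebra
            finally show "cy (psi (Affine x y)) = ?u (Affine x y) * (cx (Affine x y) - x0)"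
              using h(2) by (simp add: power2_eq_square)
          qed
        qed
      qed
    qed
  qed
qed

lemma unramified_psi: "P \<in> E \<Longrightarrow> unramified_at E E psi P"
proof (erule ec_pointE)
  fix x y assume P: "P = Affine x y" "y ^ 2 = x ^ 3 - x"
  show "unramified_at E E psi P"
  proof (cases "x = 0")
    case True
    then have "y = 0" using P(2) by simp
    then show ?thesis using P(1) True unramified_psi_kernel by simp
  next
    case False
    then show ?thesis using unramified_psi_affine[of x y] P by simp
  qed
qed (simp only: unramified_psi_origin)

text \<open>\<open>x^2 - x0^2 = (x + x0) (x - x0)\<close>, where \<open>x + x0\<close> is a unit
  since \<open>x0 \<noteq> 0\<close>, and \<open>x - x0\<close> is a uniformizer since
  \<open>x0 (x0^2 - 1) \<noteq> 0\<close> gives \<open>y0 \<noteq> 0\<close>.\<close>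

lemma unramified_phi:
  assumes P: "P \<in> E" and "phi P \<notin> zero_one_infty"
  shows "unramified_at E UNIV phi P"
  using P
proof (cases rule: ec_pointE)
  case 1
  then show ?thesis using assms(2) by (simp add: zero_one_infty_def)
next
  case (2 x0 y0)
  have x0: "x0 \<noteq> 0" "x0 ^ 2 \<noteq> 1"
    using assms(2) 2(1) by (auto simp: zero_one_infty_def)
  have "y0 ^ 2 = x0 * (x0 ^ 2 - 1)"
    using 2(2) by (simp add: right_diff_distrib power2_eq_square power3_eq_cube)
  then have y0: "y0 \<noteq> 0" using x0 by auto
  note reg = regular_affine_coords[of x0 y0]
  have P': "Affine x0 y0 \<in> E" using 2(2) by simp
  show ?thesis
    unfolding 2(1)
  proof (rule unramified_atI[OF morphism_phi P'])
    show "uniformizer UNIV (phi (Affine x0 y0)) (\<lambda>Q. coords Q 0 / coords Q 1 - x0 ^ 2)"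
      unfolding phi.simps by (rule uniformizer_proj_line)
    show "uniformizer E (Affine x0 y0) (\<lambda>Q. coords (phi Q) 0 / coords (phi Q) 1 - x0 ^ 2)"
    proof (rule uniformizer_unit_multiple[OF uniformizer_x[OF P' y0] P'])
      show "regular_at E (Affine x0 y0) (\<lambda>Q. cx Q + x0)"
        by (intro regular_at_add regular_at_const reg)
      show "cx (Affine x0 y0) + x0 \<noteq> 0"
        using x0 by simp
      show "zariski_near E (Affine x0 y0)
          (\<lambda>Q. coords (phi Q) 0 / coords (phi Q) 1 - x0 ^ 2 = (cx Q + x0) * (cx Q - x0))"
        by (rule near_affineI) (simp add: power2_eq_square algebra_simps)
    qed
  qed
qed

section \<open>The Belyi pairs\<close>

definition beta :: "nat \<Rightarrow> ec_point \<Rightarrow> proj_line" where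
  "beta k P = phi ((psi ^^ k) P)"

lemma psi_funpow_in_E: "P \<in> E \<Longrightarrow> (psi ^^ k) P \<in> E"
  by (induction k) (auto intro: psi_in_E)

lemma psi_funpow_Origin: "(psi ^^ k) Origin = Origin"
  by (induction k) auto

lemma morphism_psi_funpow: "morphism E E (psi ^^ k)"
proof (induction k)
  case 0
  then show ?case using morphism_id[of E] by (simp add: id_def)
next
  case (Suc k)
  then show ?case using morphism_compose[OF Suc morphism_psi] by (simp add: comp_def)
qed

lemma morphism_beta: "morphism E UNIV (beta k)"
  using morphism_compose[OF morphism_psi_funpow morphism_phi] unfolding beta_def[abs_def] .

lemma unramified_psi_funpow: "P \<in> E \<Longrightarrow> unramified_at E E (psi ^^ k) P"
proof (induction k)
  case 0
  then show ?case using unramified_at_id[of E P] by (simp add: id_def)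
next
  case (Suc k)
  then show ?case
    using unramified_at_compose[OF Suc.IH unramified_psi[OF psi_funpow_in_E]] by (simp add: comp_def)
qed

lemma critical_values_beta: "critical_values E UNIV (beta k) \<subseteq> zero_one_infty"
proof -
  have False if P: "P \<in> critical_points E UNIV (beta k)" and b: "beta k P \<notin> zero_one_infty" for P
  proof -
    have PE: "P \<in> E" and r: "ramification_index E UNIV (beta k) P \<ge> 2"
      using P by (auto simp: critical_points_def)
    have unr: "unramified_at E UNIV (beta k) P"
      using unramified_at_compose[OF unramified_psi_funpow[OF PE] unramified_phi[OF psi_funpow_in_E[OF PE]]] b
      unfolding beta_def[abs_def] by blast
    obtain a where a: "beta k P = Fin a"
      using b by (cases "beta k P") (auto simp: zero_one_infty_def)
    from PE show False
    proof (cases rule: ec_pointE)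
      case 1
      then show False using a by (simp add: beta_def psi_funpow_Origin)
    next
      case (2 x0 y0)
      have t: "uniformizer UNIV (beta k P) (\<lambda>Q. coords Q 0 / coords Q 1 - a)"
        unfolding a by (rule uniformizer_proj_line)
      have "ramification_index E UNIV (beta k) P = 1"
      proof (rule ramification_index_unramified[OF morphism_beta PE t unr])
        \<comment> \<open>\<open>x - x0\<close> is the witness that \<open>P\<close> is not
          isolated.\<close>
        show "regular_at E P (\<lambda>Q. cx Q - x0)"
          unfolding 2(1) by (intro regular_at_diff regular_at_const regular_affine_coords)
        show "\<not> zariski_near E P (\<lambda>Q. cx Q - x0 = 0)"
          using affine_not_isolated[of x0 y0] PE unfolding 2(1) .
      qed (simp add: 2(1))
      then show False using r by simp
    qed
  qed
  then show ?thesis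
    by (auto simp: critical_values_def)
qed

section \<open>Quasi-critical sets as iterated preimages of the 2-torsion\<close>

definition two_torsion :: "ec_point set" where
  "two_torsion = {Origin, Affine 0 0, Affine 1 0, Affine (-1) 0}"

lemma two_torsion_subset: "two_torsion \<subseteq> E"
  by (auto simp: two_torsion_def)

lemma phi_quasi_critical: "P \<in> E \<Longrightarrow> phi P \<in> zero_one_infty \<longleftrightarrow> P \<in> two_torsion"
  by (erule ec_pointE) (auto simp: zero_one_infty_def two_torsion_def power2_eq_1_iff)

lemma quasi_critical_beta: "quasi_critical_points curve (beta k) = {P\<in>E. (psi ^^ k) P \<in> two_torsion}"
  unfolding quasi_critical_points_def beta_def using phi_quasi_critical[OF psi_funpow_in_E] by blast

lemma card_quasi_critical_beta:
  "finite (quasi_critical_points curve (beta k)) \<and> card (quasi_critical_points curve (beta k)) = 4 * 2 ^ k"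
proof (induction k)
  case 0
  have "{P\<in>E. P \<in> two_torsion} = two_torsion"
    using two_torsion_subset by blast
  then show ?case
    by (simp add: quasi_critical_beta two_torsion_def)
next
  case (Suc k)
  let ?A = "quasi_critical_points curve (beta k)"
  have "quasi_critical_points curve (beta (Suc k)) = {P\<in>E. psi P \<in> ?A}"
    unfolding quasi_critical_beta using psi_in_E by (auto simp: funpow_swap1)
  moreover have "?A \<subseteq> E"
    by (auto simp: quasi_critical_points_def)
  ultimately show ?case
    using card_psi_preimage[of ?A] Suc by simp
qed

lemma psi_funpow_ec_add:
  "P \<in> E \<Longrightarrow> Q \<in> E \<Longrightarrow> (psi ^^ k) (ec_add curve P Q) = ec_add curve ((psi ^^ k) P) ((psi ^^ k) Q)"
  by (induction k) (simp_all add: psi_ec_add psi_funpow_in_E)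

lemma psi_funpow_ec_neg: "(psi ^^ k) (ec_neg P) = ec_neg ((psi ^^ k) P)"
  by (induction k) (simp_all add: psi_ec_neg)

lemma subgroup_quasi_critical_beta: "subgroup (quasi_critical_points curve (beta k)) (ec_group curve)"
proof
  \<comment> \<open>Closure of the 2-torsion is checked on its 16 pairs by evaluating
    \<open>ec_add\<close>; the homomorphism \<open>psi ^^ k\<close> then transports it to the
    preimage.\<close>
  have add: "ec_add curve P Q \<in> two_torsion" if "P \<in> two_torsion" "Q \<in> two_torsion" for P Q
    using that by (auto simp: two_torsion_def Let_def)
  have neg: "ec_neg P \<in> two_torsion" if "P \<in> two_torsion" for P
    using that by (auto simp: two_torsion_def)
  show "quasi_critical_points curve (beta k) \<subseteq> carrier (ec_group curve)"
    by (auto simp: quasi_critical_points_def ec_group_def)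
  show "\<one>\<^bsub>ec_group curve\<^esub> \<in> quasi_critical_points curve (beta k)"
    by (simp add: quasi_critical_beta psi_funpow_Origin ec_group_def two_torsion_def)
  show "P \<otimes>\<^bsub>ec_group curve\<^esub> Q \<in> quasi_critical_points curve (beta k)"
    if "P \<in> quasi_critical_points curve (beta k)" "Q \<in> quasi_critical_points curve (beta k)" for P Q
    using that add by (simp add: quasi_critical_beta psi_funpow_ec_add ec_add_in_E ec_group_def)
  show "inv\<^bsub>ec_group curve\<^esub> P \<in> quasi_critical_points curve (beta k)"
    if "P \<in> quasi_critical_points curve (beta k)" for P
    using that neg by (simp add: quasi_critical_beta inv_ec_group psi_funpow_ec_neg ec_neg_in_E)
qed

lemma toroidal_belyi_pair_beta: "toroidal_belyi_pair curve (beta k)"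
proof -
  have "\<not> beta k constant_on E"
  proof
    \<comment> \<open>The constant would be the value \<open>Infty\<close> at \<open>Origin\<close>,
      making all of the infinite set \<open>E\<close> quasi-critical, whereas the quasi-critical set
      is finite.\<close>
    assume "beta k constant_on E"
    then have "beta k P = beta k Origin" if "P \<in> E" for P
      using that unfolding constant_on_def by (metis Origin_in_E)
    moreover have "beta k Origin \<in> zero_one_infty"
      by (simp add: beta_def psi_funpow_Origin zero_one_infty_def)
    ultimately have "\<forall>P\<in>E. beta k P \<in> zero_one_infty"
      by metis
    then have "quasi_critical_points curve (beta k) = E"
      unfolding quasi_critical_points_def by blast
    then show False
      using card_quasi_critical_beta infinite_E by metis
  qed
  then show ?thesis
    unfolding toroidal_belyi_pair_def belyi_map_def
    using elliptic_curve_curve morphism_beta critical_values_beta by blast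
qed

text \<open>One factor \<open>psi\<close> is split off as the isogeny and \<open>beta k\<close> is
  the middle map; hence the successor in the index.\<close>

lemma imprimitive_beta: "imprimitive curve (beta (Suc k))"
  unfolding imprimitive_def
proof (intro exI conjI)
  show "\<forall>P\<in>E. beta (Suc k) P = (\<lambda>Q. Q) (beta k (psi P))"
    by (simp add: beta_def funpow_swap1)
  show "map_degree UNIV UNIV (\<lambda>Q :: proj_line. Q) \<ge> 2 \<or> map_degree E E psi \<ge> 2"
    by (simp add: map_degree_psi)
qed (rule elliptic_curve_curve isogeny_psi morphism_beta dynamical_belyi_map_id)+

text \<open>An isomorphism may move the origin, so the invariant has to ignore the group structure:
  compatibility with the Belyi maps alone restricts it to a bijection of quasi-critical
  sets.\<close>

lemma isomorphic_pairs_card: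
  assumes "isomorphic_pairs (C, \<beta>) (C', \<beta>')"
  shows "card (quasi_critical_points C \<beta>) = card (quasi_critical_points C' \<beta>')"
proof -
  obtain f g where fg: "morphism (ec_points C) (ec_points C') f" "morphism (ec_points C') (ec_points C) g"
    "\<forall>P\<in>ec_points C. g (f P) = P" "\<forall>P\<in>ec_points C'. f (g P) = P" "\<forall>P\<in>ec_points C. \<beta> P = \<beta>' (f P)"
    using assms unfolding isomorphic_pairs_def by blast
  have "\<And>P. P \<in> ec_points C \<Longrightarrow> f P \<in> ec_points C'" "\<And>P. P \<in> ec_points C' \<Longrightarrow> g P \<in> ec_points C"
    using fg(1,2) unfolding morphism_def by blast+
  then have "bij_betw f (quasi_critical_points C \<beta>) (quasi_critical_points C' \<beta>')"
    using fg(3-5) by (intro bij_betw_byWitness[where f' = g]) (auto simp: quasi_critical_points_def)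
  then show ?thesis
    by (rule bij_betw_same_card)
qed

theorem corollary15:
  shows "\<exists>S :: (weierstrass \<times> (ec_point \<Rightarrow> proj_line)) set.
    infinite S \<and>
    (\<forall>(E, \<beta>)\<in>S. toroidal_belyi_pair E \<beta> \<and> imprimitive E \<beta> \<and>
       subgroup (quasi_critical_points E \<beta>) (ec_group E)) \<and>
    pairwise (\<lambda>p q. \<not> isomorphic_pairs p q) S"
proof (intro exI conjI)
  let ?pair = "\<lambda>k. (curve, beta (Suc k))"
  \<comment> \<open>This one invariant yields both injectivity of the family and pairwise
    non-isomorphism.\<close>
  have card_eq: "j = k" if "card (quasi_critical_points curve (beta (Suc j))) =
      card (quasi_critical_points curve (beta (Suc k)))" for j k
    using that by (simp add: card_quasi_critical_beta)
  have "inj ?pair"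
    by (rule injI) (metis card_eq Pair_inject)
  then show "infinite (range ?pair)"
    by (rule range_inj_infinite)
  show "\<forall>(E, \<beta>)\<in>range ?pair. toroidal_belyi_pair E \<beta> \<and> imprimitive E \<beta> \<and>
      subgroup (quasi_critical_points E \<beta>) (ec_group E)"
    using toroidal_belyi_pair_beta imprimitive_beta subgroup_quasi_critical_beta by auto
  show "pairwise (\<lambda>p q. \<not> isomorphic_pairs p q) (range ?pair)"
    unfolding pairwise_def using isomorphic_pairs_card card_eq by blast
qed

end
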